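(* Let $(\mathcal{C},d_{\mathcal{C}})$ be a Hilbert geometry, with $\mathcal{C}$ a (nonempty) bounded open convex set in $\mathbb{R}^n$. Then $$\lambda_1(\mathcal{C})\le\frac{(n-1)^2}{4}.$$
   Context: The Hilbert geometry of a nonempty bounded open convex set $\mathcal{C}\subset\mathbb{R}^n$ carries the Finsler metric: for $p\in\mathcal{C}$, $v\neq0$ in $\mathbb{R}^n$, the line through $p$ directed by $v$ meets $\partial\mathcal{C}$ at $p^+,p^-$ and $F_{\mathcal{C}}(p,v)=\frac12\|v\|\left(\frac1{\|p-p^-\|}+\frac1{\|p-p^+\|}\right)$, $F_{\mathcal{C}}(p,0)=0$, with $\|\cdot\|$ the Euclidean norm; the Hilbert distance $d_{\mathcal{C}}$ is the associated length distance. Dual norm: $\|\ell\|_{\mathcal{C}}^*=\sup\{|\ell(v)|: F_{\mathcal{C}}(p,v)\le1\}$ for a linear form $\ell$ at $p$. Hilbert measure: $\mu_{\mathcal{C}}(A)=\int_A \frac{\omega_n}{\mathrm{Vol}(\{v: F_{\mathcal{C}}(p,v)<1\})}\,d\mathrm{Vol}(p)$ for Borel $A\subset\mathcal{C}$, with $\mathrm{Vol}$ the Lebesgue measure and $\omega_n$ the volume of the Euclidean unit ball of $\mathbb{R}^n$. Bottom of the spectrum: $\lambda_1(\mathcal{C})=\inf_f \frac{\int_{\mathcal{C}}(\|df_p\|_{\mathcal{C}}^* )^2\,d\mu_{\mathcal{C}}(p)}{\int_{\mathcal{C}}f^2(p)\,d\mu_{\mathcal{C}}(p)}$ over all nonzero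 Lipschitz functions $f$ with compact support in $\mathcal{C}$. *)

theory Defs
  imports "HOL-Analysis.Analysis"
begin

definition exit_point :: "'a::euclidean_space set \<Rightarrow> 'a \<Rightarrow> 'a \<Rightarrow> 'a" where
  "exit_point C p v = (THE q. q \<in> frontier C \<and> (\<exists>t>0. q = p + t *\<^sub>R v))"

text \<open>The points \<open>p\<^sup>+\<close> and \<open>p\<^sup>-\<close> are \<open>exit_point C p v\<close> and \<open>exit_point C p (- v)\<close>.\<close>

definition finsler :: "'a::euclidean_space set \<Rightarrow> 'a \<Rightarrow> 'a \<Rightarrow> real" where
  "finsler C p v =
     (if v = 0 then 0
      else 1/2 * norm v * (1 / norm (p - exit_point C p (- v)) + 1 / norm (p - exit_point C p v)))"

text \<open>A valid path is only \<open>C\<^sup>1\<close> off a finite set, with no control of the derivative near the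
  exceptional points, so its length may be infinite. Using \<open>has_integral\<close> leaves out
  exactly the paths of infinite length, which do not affect the infimum; the total function
  \<open>integral\<close> would instead assign them length \<open>0\<close>.\<close>

definition hilbert_dist :: "'a::euclidean_space set \<Rightarrow> 'a \<Rightarrow> 'a \<Rightarrow> real" where
  "hilbert_dist C x y =
     Inf {l. \<exists>\<gamma>. valid_path \<gamma> \<and> path_image \<gamma> \<subseteq> C \<and> pathstart \<gamma> = x \<and> pathfinish \<gamma> = y \<and>
                 ((\<lambda>t. finsler C (\<gamma> t) (vector_derivative \<gamma> (at t))) has_integral l) {0..1}}"

definition dual_norm :: "'a::euclidean_space set \<Rightarrow> 'a \<Rightarrow> ('a \<Rightarrow> real) \<Rightarrow> real" where
  "dual_norm C p l = Sup {\<bar>l v\<bar> | v. finsler C p v \<le> 1}"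

definition hilbert_measure :: "'a::euclidean_space set \<Rightarrow> 'a measure" where
  "hilbert_measure C =
     density (restrict_space lborel C)
       (\<lambda>p. ennreal (measure lborel (ball (0::'a) 1) / measure lborel {v. finsler C p v < 1}))"

text \<open>Functions on \<open>C\<close> are represented by total functions; their values outside \<open>C\<close>
  are not used anywhere.\<close>

definition test_function :: "'a::euclidean_space set \<Rightarrow> ('a \<Rightarrow> real) \<Rightarrow> bool" where
  "test_function C f \<longleftrightarrow>
     (\<exists>L. \<forall>x\<in>C. \<forall>y\<in>C. \<bar>f x - f y\<bar> \<le> L * hilbert_dist C x y) \<and>
     compact (closure {p \<in> C. f p \<noteq> 0}) \<and> closure {p \<in> C. f p \<noteq> 0} \<subseteq> C \<and>
     (\<exists>p\<in>C. f p \<noteq> 0)"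

text \<open>The differential of a Lipschitz function exists almost everywhere (Rademacher), so the
  energy is integrated over the points of differentiability. The integrals
  are taken in \<^typ>\<open>ennreal\<close>; for a test function the
  denominator is positive and finite.\<close>

definition bottom_spectrum :: "'a::euclidean_space set \<Rightarrow> ennreal" where
  "bottom_spectrum C =
     (INF f \<in> {f. test_function C f}.
        (\<integral>\<^sup>+p\<in>{p. f differentiable (at p)}.
            ennreal ((dual_norm C p (frechet_derivative f (at p)))\<^sup>2) \<partial>hilbert_measure C) /
        (\<integral>\<^sup>+p. ennreal ((f p)\<^sup>2) \<partial>hilbert_measure C))"

end

theory Submission
  imports Defs
begin

text \<open>Let \<open>u(p)\<close> be the Euclidean distance from \<open>p\<close> to the complement of \<open>C\<close>. It is concave and
  positive, so along the line through \<open>p\<close> the function \<open>ln u\<close> has slope between \<open>- 1 / \<parallel>p - p\<^sup>+\<parallel>\<close>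
  and \<open>1 / \<parallel>p - p\<^sup>-\<parallel>\<close>, whence \<open>\<parallel>d ln u\<parallel>\<^sup>* \<le> 2\<close>. Hence \<open>u powr (s/2)\<close>, truncated near the boundary, has Rayleigh
  quotient at most \<open>s\<^sup>2\<close> in the limit, as soon as \<open>\<integral> u powr s d\<mu>\<close> is finite; the claim is that it
  is for all \<open>s > (n - 1) / 2\<close>.

  A reverse Santalo inequality bounds the density of \<open>\<mu>\<close> at \<open>p\<close> by the volume of the polar body
  \<open>P(p) = (C - p)\<degree>\<close>. In the shell \<open>t < u \<le> 2 t\<close> one integrates this volume by Fubini after the
  substitution \<open>y = c - p / t\<close> for \<open>y \<in> P(p)\<close>: here \<open>c\<close> ranges over a ball of radius \<open>O(1 / t)\<close>, and
  since \<open>(p - p') \<bullet> (y - y') \<ge> - 2\<close> whenever \<open>y \<in> P(p)\<close> and \<open>y' \<in> P(p')\<close>, for fixed \<open>c\<close> the point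
  \<open>p\<close> stays in a piece of the shell of diameter \<open>sqrt (2 t)\<close>, whose volume is \<open>O(t powr ((n + 1) / 2))\<close>.
  The shell thus contributes \<open>O(t powr ((1 - n) / 2))\<close>, and the dyadic sum of
  \<open>t powr (s + (1 - n) / 2)\<close> converges.\<close>

section \<open>The Finsler metric and the Hilbert distance\<close>

locale bounded_open_convex =
  fixes C :: "'a::euclidean_space set"
  assumes nonempty: "C \<noteq> {}" and bounded: "bounded C" and open_C: "open C" and convex: "convex C"
begin

text \<open>Since \<open>p\<close> is interior, every point strictly between \<open>p\<close> and a
  point of \<open>closure C\<close> is interior, so the ray meets the frontier exactly once. This
  makes the \<open>THE\<close> in \<open>exit_point\<close> well defined and turns membership along
  the ray into a comparison with \<open>a\<close>.\<close>

lemma exit_time: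
  assumes p: "p \<in> C" and v: "v \<noteq> 0"
  obtains a where "a > 0" "exit_point C p v = p + a *\<^sub>R v"
    "\<And>s. s \<ge> 0 \<Longrightarrow> p + s *\<^sub>R v \<in> C \<longleftrightarrow> s < a"
proof -
  have int: "interior C = C" using open_C by (simp add: interior_open)
  obtain a where a: "0 < a" "p + a *\<^sub>R v \<in> frontier C"
    and in_C: "\<And>e. \<lbrakk>0 \<le> e; e < a\<rbrakk> \<Longrightarrow> p + e *\<^sub>R v \<in> C"
    using ray_to_frontier[OF bounded, of p v] p v int by metis
  have closure_le: "s \<le> a" if "s > 0" "p + s *\<^sub>R v \<in> closure C" for s
  proof (rule ccontr)
    assume "\<not> s \<le> a"
    with a(1) have "p + s *\<^sub>R v - (1 - a / s) *\<^sub>R (p + s *\<^sub>R v - p) \<in> interior C"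
      using mem_interior_closure_convex_shrink[OF convex, of p "p + s *\<^sub>R v" "1 - a / s"] p that int
      by (auto simp: field_simps)
    moreover have "p + s *\<^sub>R v - (1 - a / s) *\<^sub>R (p + s *\<^sub>R v - p) = p + a *\<^sub>R v"
      using that by (simp add: algebra_simps)
    ultimately have "p + a *\<^sub>R v \<in> interior C" by metis
    then show False using a(2) by (simp add: frontier_def)
  qed
  have not_C: "p + a *\<^sub>R v \<notin> C" using a(2) int by (simp add: frontier_def)
  have C_iff: "p + s *\<^sub>R v \<in> C \<longleftrightarrow> s < a" if "s \<ge> 0" for s
  proof
    assume s: "p + s *\<^sub>R v \<in> C"
    show "s < a"
    proof (cases "s = 0")
      case False
      then have "s \<le> a" using closure_le[of s] s that closure_subset by fastforce
      moreover have "s \<noteq> a" using s not_C by auto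
      ultimately show ?thesis by simp
    qed (use a in simp)
  qed (use in_C that in auto)
  have "exit_point C p v = p + a *\<^sub>R v"
    unfolding exit_point_def
  proof (rule the_equality)
    show "p + a *\<^sub>R v \<in> frontier C \<and> (\<exists>t>0. p + a *\<^sub>R v = p + t *\<^sub>R v)" using a by auto
  next
    fix q assume "q \<in> frontier C \<and> (\<exists>t>0. q = p + t *\<^sub>R v)"
    then obtain t where t: "t > 0" "q = p + t *\<^sub>R v" "q \<in> closure C" "q \<notin> C"
      using int by (auto simp: frontier_def)
    then have "t \<le> a" "\<not> t < a" using closure_le[of t] C_iff[of t] by auto
    then show "q = p + a *\<^sub>R v" using t by simp
  qed
  then show thesis using that a(1) C_iff by blast
qed

lemma finsler_exit_times:
  assumes p: "p \<in> C" and v: "v \<noteq> 0"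
  obtains a b where "a > 0" "b > 0" "finsler C p v = (1 / a + 1 / b) / 2"
    "\<And>s. s \<ge> 0 \<Longrightarrow> p + s *\<^sub>R v \<in> C \<longleftrightarrow> s < a"
    "\<And>s. s \<ge> 0 \<Longrightarrow> p - s *\<^sub>R v \<in> C \<longleftrightarrow> s < b"
proof -
  obtain a where a: "a > 0" "exit_point C p v = p + a *\<^sub>R v"
    "\<And>s. s \<ge> 0 \<Longrightarrow> p + s *\<^sub>R v \<in> C \<longleftrightarrow> s < a" using exit_time[OF p v] by blast
  obtain b where b: "b > 0" "exit_point C p (- v) = p + b *\<^sub>R - v"
    "\<And>s. s \<ge> 0 \<Longrightarrow> p + s *\<^sub>R - v \<in> C \<longleftrightarrow> s < b" using exit_time[OF p, of "- v"] v by auto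
  have "finsler C p v = (1 / a + 1 / b) / 2"
    unfolding finsler_def a b using v a(1) b(1) by (simp add: field_simps)
  with a b show thesis by (intro that) auto
qed

text \<open>Here \<open>c\<close> and \<open>d\<close> are upper bounds for the reciprocal exit
  times. The right-hand side only asks for points to lie in the open set \<open>C\<close>, which
  yields openness jointly in \<open>p\<close> and \<open>v\<close>.\<close>

lemma finsler_less_1_iff:
  assumes p: "p \<in> C"
  shows "finsler C p v < 1 \<longleftrightarrow> (\<exists>c>0. \<exists>d>0. c + d \<le> 2 \<and> p + (1 / c) *\<^sub>R v \<in> C \<and> p - (1 / d) *\<^sub>R v \<in> C)"
proof (cases "v = 0")
  case True
  have "\<exists>c>0. \<exists>d>0. c + d \<le> (2::real)" by (rule exI[of _ 1], simp, rule exI[of _ 1], simp)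
  with True p show ?thesis by (simp add: finsler_def)
next
  case False
  obtain a b where ab: "a > 0" "b > 0" "finsler C p v = (1 / a + 1 / b) / 2"
    "\<And>s. s \<ge> 0 \<Longrightarrow> p + s *\<^sub>R v \<in> C \<longleftrightarrow> s < a"
    "\<And>s. s \<ge> 0 \<Longrightarrow> p - s *\<^sub>R v \<in> C \<longleftrightarrow> s < b"
    using finsler_exit_times[OF p False] by blast
  have "(1 / a + 1 / b) / 2 < 1 \<longleftrightarrow> (\<exists>c>0. \<exists>d>0. c + d \<le> 2 \<and> 1 / c < a \<and> 1 / d < b)"
  proof
    assume *: "(1 / a + 1 / b) / 2 < 1"
    \<comment> \<open>Half of the slack goes to each reciprocal, so that the enlarged ones add up to
      exactly 2.\<close>
    define e where "e = (2 - (1 / a + 1 / b)) / 2"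
    have e: "e > 0" using * by (simp add: e_def)
    have "1 / (1 / a + e) < 1 / (1 / a)" "1 / (1 / b + e) < 1 / (1 / b)"
      using ab(1,2) e by (intro divide_strict_left_mono; simp add: add_pos_pos)+
    then have "1 / (1 / a + e) < a" "1 / (1 / b + e) < b" by simp_all
    moreover have "1 / a + e > 0" "1 / b + e > 0" "(1 / a + e) + (1 / b + e) \<le> 2"
      using ab e by (auto simp: e_def add_pos_pos field_simps)
    ultimately show "\<exists>c>0. \<exists>d>0. c + d \<le> 2 \<and> 1 / c < a \<and> 1 / d < b" by blast
  next
    assume "\<exists>c>0. \<exists>d>0. c + d \<le> 2 \<and> 1 / c < a \<and> 1 / d < b"
    then obtain c d where cd: "c > 0" "d > 0" "c + d \<le> 2" "1 / c < a" "1 / d < b" by auto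
    then have "1 / a < c" "1 / b < d" using ab by (simp_all add: field_simps)
    with cd show "(1 / a + 1 / b) / 2 < 1" by simp
  qed
  also have "\<dots> \<longleftrightarrow> (\<exists>c>0. \<exists>d>0. c + d \<le> 2 \<and> p + (1 / c) *\<^sub>R v \<in> C \<and> p - (1 / d) *\<^sub>R v \<in> C)"
    by (intro ex_cong1 conj_cong refl ab(4,5)[symmetric]) auto
  finally show ?thesis by (simp only: ab(3))
qed

lemma finsler_less_1I: "p + v \<in> C \<Longrightarrow> p - v \<in> C \<Longrightarrow> p \<in> C \<Longrightarrow> finsler C p v < 1"
  unfolding finsler_less_1_iff by (rule exI[of _ 1], simp, rule exI[of _ 1], simp)

text \<open>This makes the volume of the unit ball measurable in \<open>p\<close>, and with it the
  density of the Hilbert measure.\<close>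

lemma open_finsler_balls: "open {(p, v). p \<in> C \<and> finsler C p v < 1}"
proof -
  have "{(p, v). p \<in> C \<and> finsler C p v < 1} =
      (\<Union>(c, d)\<in>{(c, d). c > 0 \<and> d > 0 \<and> c + d \<le> 2}.
        {(p, v). p \<in> C \<and> p + (1 / c) *\<^sub>R v \<in> C \<and> p - (1 / d) *\<^sub>R v \<in> C})"
    using finsler_less_1_iff by fastforce
  moreover have "open {(p, v). p \<in> C \<and> p + (1 / c) *\<^sub>R v \<in> C \<and> p - (1 / d) *\<^sub>R v \<in> C}" for c d :: real
  proof -
    have "open ((fst -` C) \<inter> (\<lambda>x. fst x + (1 / c) *\<^sub>R snd x) -` C \<inter> (\<lambda>x. fst x - (1 / d) *\<^sub>R snd x) -` C)"
      by (intro open_Int open_vimage open_C continuous_intros)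
    moreover have "((fst -` C) \<inter> (\<lambda>x. fst x + (1 / c) *\<^sub>R snd x) -` C \<inter> (\<lambda>x. fst x - (1 / d) *\<^sub>R snd x) -` C)
      = {(p, v). p \<in> C \<and> p + (1 / c) *\<^sub>R v \<in> C \<and> p - (1 / d) *\<^sub>R v \<in> C}" by auto
    ultimately show ?thesis by simp
  qed
  ultimately show ?thesis by (auto intro!: open_UN)
qed

text \<open>Both half-chords, of lengths \<open>a * norm v\<close> and \<open>b * norm v\<close>,
  are at most the diameter; the two resulting bounds on \<open>norm v\<close> are averaged.\<close>

lemma norm_le_diameter_finsler:
  assumes p: "p \<in> C"
  shows "norm v \<le> diameter C * finsler C p v"
proof (cases "v = 0")
  case False
  obtain a b where ab: "a > 0" "b > 0" "finsler C p v = (1 / a + 1 / b) / 2"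
    "\<And>s. s \<ge> 0 \<Longrightarrow> p + s *\<^sub>R v \<in> C \<longleftrightarrow> s < a"
    "\<And>s. s \<ge> 0 \<Longrightarrow> p - s *\<^sub>R v \<in> C \<longleftrightarrow> s < b"
    using finsler_exit_times[OF p False] by blast
  have *: "s * norm v \<le> diameter C" if "0 \<le> s" "s < max a b" for s
  proof -
    have "p + s *\<^sub>R v \<in> C \<or> p - s *\<^sub>R v \<in> C" using ab that by auto
    then have "dist p (p + s *\<^sub>R v) \<le> diameter C \<or> dist p (p - s *\<^sub>R v) \<le> diameter C"
      using diameter_bounded_bound[OF bounded p] by metis
    then show ?thesis using that by (simp add: dist_norm)
  qed
  \<comment> \<open>The exit points are not in \<open>C\<close>, so \<open>*\<close> stops short of
    the exit times. They are reached through earlier times, such as the midpoint of \<open>q\<close>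
    and \<open>m\<close>.\<close>
  have "m * norm v \<le> diameter C" if "0 < m" "m \<le> max a b" for m
  proof (rule ccontr)
    assume c: "\<not> m * norm v \<le> diameter C"
    have D: "diameter C \<ge> 0" by (simp add: diameter_ge_0 bounded)
    define q where "q = diameter C / norm v"
    have "q \<ge> 0" "q < m" "q * norm v = diameter C" using c D False by (simp_all add: q_def field_simps)
    with that *[of "(q + m) / 2"] have "(q + m) / 2 * norm v \<le> q * norm v" by auto
    with \<open>q < m\<close> False show False by simp
  qed
  from this[of a] this[of b] ab(1,2) have "norm v \<le> diameter C * (1 / a)" "norm v \<le> diameter C * (1 / b)"
    by (simp_all add: field_simps)
  then have "norm v + norm v \<le> diameter C * (1 / a + 1 / b)" by (simp only: distrib_left)
  then show ?thesis unfolding ab(3) by simp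
qed (simp add: finsler_def)

lemma diameter_pos: "diameter C > 0"
proof -
  obtain o' where o: "o' \<in> C" using nonempty by blast
  then obtain e where e: "e > 0" "cball o' e \<subseteq> C" using open_C open_contains_cball by blast
  obtain b :: 'a where b: "b \<in> Basis" using nonempty_Basis by blast
  then have "o' + e *\<^sub>R b \<in> C" using e by (auto simp: dist_norm)
  then have "dist o' (o' + e *\<^sub>R b) \<le> diameter C" using diameter_bounded_bound[OF bounded o] by blast
  with b e show ?thesis by (simp add: dist_norm)
qed

lemma finsler_ball_bounded:
  assumes "p \<in> C"
  shows "{v. finsler C p v < 1} \<subseteq> ball 0 (diameter C)"
proof
  fix v assume "v \<in> {v. finsler C p v < 1}"
  then have "diameter C * finsler C p v < diameter C * 1"
    using diameter_pos by (intro mult_strict_left_mono) auto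
  then show "v \<in> ball 0 (diameter C)" using norm_le_diameter_finsler[OF assms, of v] by simp
qed

text \<open>Along a segment both exit points are fixed, so the integrand is an explicit rational function.\<close>

lemma finsler_integrable_on_segment:
  assumes x: "x \<in> C" and y: "y \<in> C"
  shows "(\<lambda>t. finsler C (linepath x y t) (y - x)) integrable_on {0..1}"
proof (cases "x = y")
  case True
  then have "(\<lambda>t. finsler C (linepath x y t) (y - x)) = (\<lambda>t. 0)" by (simp add: finsler_def)
  then show ?thesis by (simp only: integrable_0)
next
  case False
  define v where "v = y - x"
  have v: "v \<noteq> 0" using False by (simp add: v_def)
  obtain a where a: "a > 0" "exit_point C x v = x + a *\<^sub>R v"
    "\<And>s. s \<ge> 0 \<Longrightarrow> x + s *\<^sub>R v \<in> C \<longleftrightarrow> s < a" using exit_time[OF x v] by blast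
  obtain b where b: "b > 0" "exit_point C x (- v) = x + b *\<^sub>R - v"
    "\<And>s. s \<ge> 0 \<Longrightarrow> x + s *\<^sub>R - v \<in> C \<longleftrightarrow> s < b" using exit_time[OF x, of "- v"] v by auto
  have "a > 1" using a(3)[of 1] y by (simp add: v_def)
  have C_iff: "x + s *\<^sub>R v \<in> C \<longleftrightarrow> - b < s \<and> s < a" for s
    using a b(1) a(3)[of s] b(3)[of "- s"] by (cases "s \<ge> 0") auto
  have F: "finsler C (linepath x y t) (y - x) = (1 / (a - t) + 1 / (b + t)) / 2" if t: "t \<in> {0..1}" for t
  proof -
    have lp: "linepath x y t = x + t *\<^sub>R v" by (simp add: linepath_def v_def algebra_simps)
    have p: "x + t *\<^sub>R v \<in> C" using C_iff t \<open>a > 1\<close> \<open>b > 0\<close> by auto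
    obtain a' b' where ab: "a' > 0" "b' > 0" "finsler C (x + t *\<^sub>R v) v = (1 / a' + 1 / b') / 2"
      "\<And>s. s \<ge> 0 \<Longrightarrow> x + t *\<^sub>R v + s *\<^sub>R v \<in> C \<longleftrightarrow> s < a'"
      "\<And>s. s \<ge> 0 \<Longrightarrow> x + t *\<^sub>R v - s *\<^sub>R v \<in> C \<longleftrightarrow> s < b'"
      using finsler_exit_times[OF p v] by blast
    have "s < a' \<longleftrightarrow> s < a - t" "s < b' \<longleftrightarrow> s < b + t" if "s \<ge> 0" for s
      using ab(4,5)[OF that] C_iff[of "t + s"] C_iff[of "t - s"] t that \<open>a > 1\<close> \<open>b > 0\<close>
      by (auto simp: algebra_simps)
    from this[of a'] this[of "a - t"] this[of b'] this[of "b + t"]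
    have "a' = a - t" "b' = b + t" using ab(1,2) \<open>a > 1\<close> \<open>b > 0\<close> t by force+
    then show ?thesis using ab lp by (simp add: v_def)
  qed
  have "(\<lambda>t. (1 / (a - t) + 1 / (b + t)) / 2) integrable_on {0..1}"
    using \<open>a > 1\<close> \<open>b > 0\<close> by (intro integrable_continuous_interval continuous_intros) auto
  then show ?thesis by (rule integrable_eq) (simp add: F)
qed

text \<open>The bound of \<open>norm v\<close> by \<open>finsler\<close> is integrated along paths.
  A lower bound for \<open>Inf\<close> needs a nonempty set; the segment, whose length is finite,
  provides a member. Euclidean Lipschitz functions thereby become Lipschitz for the Hilbert
  distance.\<close>

lemma dist_le_hilbert_dist:
  assumes x: "x \<in> C" and y: "y \<in> C"
  shows "dist x y \<le> diameter C * hilbert_dist C x y"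
proof -
  let ?S = "{l. \<exists>\<gamma>. valid_path \<gamma> \<and> path_image \<gamma> \<subseteq> C \<and> pathstart \<gamma> = x \<and> pathfinish \<gamma> = y \<and>
                 ((\<lambda>t. finsler C (\<gamma> t) (vector_derivative \<gamma> (at t))) has_integral l) {0..1}}"
  have "integral {0..1} (\<lambda>t. finsler C (linepath x y t) (y - x)) \<in> ?S"
    using finsler_integrable_on_segment[OF x y] convex x y
    by (intro CollectI exI[of _ "linepath x y"])
      (auto simp: convex_contains_segment integrable_integral)
  then have ne: "?S \<noteq> {}" by blast
  have le: "dist x y / diameter C \<le> l" if "l \<in> ?S" for l
  proof -
    obtain \<gamma> where g: "valid_path \<gamma>" "path_image \<gamma> \<subseteq> C" "pathstart \<gamma> = x" "pathfinish \<gamma> = y"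
      and l: "((\<lambda>t. finsler C (\<gamma> t) (vector_derivative \<gamma> (at t))) has_integral l) {0..1}"
      using \<open>l \<in> ?S\<close> by blast
    from g(1) obtain S where S: "finite S" "continuous_on {0..1} \<gamma>" "\<gamma> C1_differentiable_on ({0..1} - S)"
      unfolding valid_path_def piecewise_C1_differentiable_on_def by auto
    have ftc: "((\<lambda>t. vector_derivative \<gamma> (at t)) has_integral \<gamma> 1 - \<gamma> 0) {0..1}"
    proof (rule fundamental_theorem_of_calculus_interior_strong[OF S(1)])
      fix t assume "t \<in> {0<..<1} - S"
      then show "(\<gamma> has_vector_derivative vector_derivative \<gamma> (at t)) (at t)"
        using S(3) unfolding C1_differentiable_on_eq
        by (auto simp: vector_derivative_works[symmetric])
    qed (use S in auto)
    have "norm (integral {0..1} (\<lambda>t. vector_derivative \<gamma> (at t)))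
        \<le> integral {0..1} (\<lambda>t. diameter C * finsler C (\<gamma> t) (vector_derivative \<gamma> (at t)))"
    proof (rule integral_norm_bound_integral)
      show "(\<lambda>t. diameter C * finsler C (\<gamma> t) (vector_derivative \<gamma> (at t))) integrable_on {0..1}"
        using integrable_on_cmult_left[OF has_integral_integrable[OF l], of "diameter C"] by simp
      fix t :: real assume "t \<in> {0..1}"
      then show "norm (vector_derivative \<gamma> (at t)) \<le> diameter C * finsler C (\<gamma> t) (vector_derivative \<gamma> (at t))"
        using g(2) by (intro norm_le_diameter_finsler) (auto simp: path_image_def)
    qed (use ftc in auto)
    then have "norm (\<gamma> 1 - \<gamma> 0) \<le> diameter C * l"
      using ftc l by (simp add: integral_unique)
    then show ?thesis using g(3,4) diameter_pos
      by (simp add: pathstart_def pathfinish_def dist_norm norm_minus_commute field_simps)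
  qed
  have "dist x y / diameter C \<le> hilbert_dist C x y"
    unfolding hilbert_dist_def by (rule cInf_greatest[OF ne le])
  then show ?thesis using diameter_pos by (simp add: field_simps)
qed

end

section \<open>Truncated powers of the distance to the boundary\<close>

text \<open>Away from 0 the derivative is bounded, also for exponents below 1. This is one reason to
  cut the test functions off at a positive depth.\<close>

lemma powr_lipschitz_on_interval:
  fixes e M s :: real
  assumes e: "0 < e"
  obtains L where "L \<ge> 0" "\<And>a b. a \<in> {e..M} \<Longrightarrow> b \<in> {e..M} \<Longrightarrow> \<bar>a powr s - b powr s\<bar> \<le> L * \<bar>a - b\<bar>"
proof -
  have "bounded ((\<lambda>x. s * x powr (s - 1)) ` {e..M})"
    using e by (intro compact_imp_bounded compact_continuous_image continuous_intros) auto
  then obtain L where L: "L > 0" "\<And>x. x \<in> {e..M} \<Longrightarrow> norm (s * x powr (s - 1)) \<le> L"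
    unfolding bounded_pos by auto
  have "norm (a powr s - b powr s) \<le> L * norm (a - b)" if "a \<in> {e..M}" "b \<in> {e..M}" for a b
  proof (rule field_differentiable_bound[OF _ _ L(2)])
    fix x assume "x \<in> {e..M}"
    then show "((\<lambda>x. x powr s) has_field_derivative s * x powr (s - 1)) (at x within {e..M})"
      using e by (auto intro!: derivative_eq_intros)
  qed (use that in auto)
  with L(1) show thesis by (intro that[of L]) auto
qed

section \<open>Distance to the complement and its powers\<close>

context bounded_open_convex
begin

definition depth :: "'a \<Rightarrow> real" where
  "depth p = infdist p (- C)"

lemma compl_nonempty: "- C \<noteq> {}"
  using bounded not_bounded_UNIV by (metis Compl_empty_eq double_compl)

lemma depth_nonneg: "depth p \<ge> 0"
  by (simp add: depth_def infdist_nonneg)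

lemma depth_pos_iff: "depth p > 0 \<longleftrightarrow> p \<in> C"
  using in_closed_iff_infdist_zero[of "- C" p] open_C compl_nonempty depth_nonneg[of p]
  by (auto simp: depth_def closed_Compl)

lemma ball_depth_subset: "ball p (depth p) \<subseteq> C"
proof
  fix q assume "q \<in> ball p (depth p)"
  then show "q \<in> C" using infdist_le[of q "- C" p] by (force simp: depth_def)
qed

lemma depth_diff_le: "\<bar>depth p - depth q\<bar> \<le> dist p q"
  unfolding depth_def by (rule infdist_triangle_abs)

lemma continuous_on_depth [continuous_intros]: "continuous_on S depth"
  unfolding depth_def by (intro continuous_intros)

lemma depth_le_diameter: "depth p \<le> diameter C"
proof (rule ccontr)
  assume *: "\<not> depth p \<le> diameter C"
  then have p: "p \<in> C" using diameter_pos depth_pos_iff[of p] by simp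
  obtain b :: 'a where b: "b \<in> Basis" using nonempty_Basis by blast
  define r where "r = (depth p + diameter C) / 2"
  have r: "diameter C < r" "r < depth p" "r > 0" using * diameter_pos by (auto simp: r_def)
  then have "p + r *\<^sub>R b \<in> C" using b ball_depth_subset[of p] by (auto simp: dist_norm)
  then have "dist p (p + r *\<^sub>R b) \<le> diameter C" using diameter_bounded_bound[OF bounded p] by blast
  with b r show False by (simp add: dist_norm)
qed

text \<open>If \<open>z\<close> lies closer to \<open>m\<close> than \<open>r\<close>, then
  \<open>p\<close> and \<open>q\<close>, shifted along \<open>z - m\<close> by the factors
  \<open>depth p / r\<close> and \<open>depth q / r\<close>, remain in \<open>C\<close>, and the
  convex combination of the shifted points is \<open>z\<close>. So no point outside \<open>C\<close>
  is that close to \<open>m\<close>.\<close>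

lemma depth_concave:
  assumes p: "p \<in> C" and q: "q \<in> C" and l: "0 \<le> l" "l \<le> 1"
  shows "(1 - l) * depth p + l * depth q \<le> depth ((1 - l) *\<^sub>R p + l *\<^sub>R q)"
proof -
  define r where "r = (1 - l) * depth p + l * depth q"
  define m where "m = (1 - l) *\<^sub>R p + l *\<^sub>R q"
  have pos: "depth p > 0" "depth q > 0" using p q depth_pos_iff by auto
  then have r: "r > 0" using l unfolding r_def
    by (cases "l = 0") (auto intro: add_nonneg_pos)
  have "r \<le> dist m z" if z: "z \<in> - C" for z
  proof (rule ccontr)
    assume "\<not> r \<le> dist m z"
    then have w: "norm (z - m) / r < 1" using r by (simp add: dist_norm norm_minus_commute)
    have "depth x * (norm (z - m) / r) < depth x * 1" if "depth x > 0" for x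
      using w that by (intro mult_strict_left_mono)
    then have "x + (depth x / r) *\<^sub>R (z - m) \<in> C" if "depth x > 0" for x
      using that r ball_depth_subset[of x] by (auto simp: subset_iff dist_norm abs_of_pos)
    then have "(1 - l) *\<^sub>R (p + (depth p / r) *\<^sub>R (z - m)) + l *\<^sub>R (q + (depth q / r) *\<^sub>R (z - m)) \<in> C"
      using pos l convex by (intro convexD) auto
    moreover have "(1 - l) *\<^sub>R (p + (depth p / r) *\<^sub>R (z - m)) + l *\<^sub>R (q + (depth q / r) *\<^sub>R (z - m))
        = m + (((1 - l) * depth p + l * depth q) / r) *\<^sub>R (z - m)"
      by (simp add: m_def scaleR_add_right scaleR_add_left add_divide_distrib)
    ultimately show False using z r by (simp add: r_def[symmetric])
  qed
  then have "r \<le> infdist m (- C)"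
    using compl_nonempty by (auto simp: infdist_notempty intro!: cINF_greatest)
  then show ?thesis by (simp add: r_def m_def depth_def)
qed

text \<open>The point \<open>p\<close> lies between \<open>p - t *\<^sub>R v\<close> and
  \<open>p + h *\<^sub>R v\<close>. Concavity on this segment, with the nonnegative term at the
  first endpoint dropped, is the integrated form of the slope bound \<open>1 / t\<close> for
  \<open>ln depth\<close>.\<close>

lemma depth_along_ray_le:
  assumes p: "p \<in> C" and t: "t > 0" "p - t *\<^sub>R v \<in> C" and h: "h \<ge> 0"
  shows "depth (p + h *\<^sub>R v) \<le> (1 + h / t) * depth p"
proof (cases "p + h *\<^sub>R v \<in> C")
  case True
  define l where "l = t / (t + h)"
  have l: "0 < l" "l \<le> 1" "(1 - l) * t = l * h" using t h by (auto simp: l_def field_simps)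
  have "(1 - l) *\<^sub>R (p - t *\<^sub>R v) + l *\<^sub>R (p + h *\<^sub>R v) = p - ((1 - l) * t) *\<^sub>R v + (l * h) *\<^sub>R v"
    by (simp add: algebra_simps)
  then have "(1 - l) * depth (p - t *\<^sub>R v) + l * depth (p + h *\<^sub>R v) \<le> depth p"
    using depth_concave[OF t(2) True, of l] l by simp
  moreover have "(1 - l) * depth (p - t *\<^sub>R v) \<ge> 0" using l depth_nonneg by simp
  ultimately have "l * depth (p + h *\<^sub>R v) \<le> depth p" by linarith
  then have "depth (p + h *\<^sub>R v) \<le> depth p / l" using l by (simp add: field_simps)
  also have "\<dots> = (1 + h / t) * depth p" using t h by (simp add: l_def field_simps)
  finally show ?thesis .
next
  case False
  then have "depth (p + h *\<^sub>R v) = 0" using depth_pos_iff depth_nonneg by (metis less_eq_real_def)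
  then show ?thesis using t h depth_nonneg by simp
qed

text \<open>Subtracting \<open>e powr s\<close> makes the function vanish up to depth
  \<open>e\<close>, hence compactly supported in \<open>C\<close> for positive \<open>e\<close>,
  without changing the differential further inside.\<close>

definition trunc_power :: "real \<Rightarrow> real \<Rightarrow> 'a \<Rightarrow> real" where
  "trunc_power e s p = max (depth p) e powr s - e powr s"

lemma test_function_trunc_power:
  assumes e: "e > 0" and s: "s > 0" and o: "o' \<in> C" "e < depth o'"
  shows "test_function C (trunc_power e s)"
  unfolding test_function_def
proof (intro conjI)
  obtain L where L: "L \<ge> 0" "\<And>a b. a \<in> {e..max (diameter C) e} \<Longrightarrow> b \<in> {e..max (diameter C) e} \<Longrightarrow>
      \<bar>a powr s - b powr s\<bar> \<le> L * \<bar>a - b\<bar>"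
    using powr_lipschitz_on_interval[OF e] by blast
  have "\<bar>trunc_power e s x - trunc_power e s y\<bar> \<le> (L * diameter C) * hilbert_dist C x y"
    if "x \<in> C" "y \<in> C" for x y
  proof -
    have "\<bar>trunc_power e s x - trunc_power e s y\<bar> \<le> L * \<bar>max (depth x) e - max (depth y) e\<bar>"
      using L(2)[of "max (depth x) e" "max (depth y) e"] depth_le_diameter[of x] depth_le_diameter[of y]
      by (auto simp: trunc_power_def)
    also have "\<dots> \<le> L * dist x y"
      using L(1) depth_diff_le[of x y] by (intro mult_left_mono) auto
    also have "\<dots> \<le> L * (diameter C * hilbert_dist C x y)"
      using L(1) dist_le_hilbert_dist[OF that] by (intro mult_left_mono)
    finally show ?thesis by (simp add: mult.assoc)
  qed
  then show "\<exists>L. \<forall>x\<in>C. \<forall>y\<in>C. \<bar>trunc_power e s x - trunc_power e s y\<bar> \<le> L * hilbert_dist C x y"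
    by blast
  have "closed (depth -` {e..})"
    using closed_vimage[OF closed_atLeast continuous_on_depth] .
  moreover have "{p \<in> C. trunc_power e s p \<noteq> 0} \<subseteq> depth -` {e..}"
    by (auto simp: trunc_power_def max_def split: if_splits)
  ultimately have sub: "closure {p \<in> C. trunc_power e s p \<noteq> 0} \<subseteq> depth -` {e..}"
    by (simp add: closure_minimal)
  then show "closure {p \<in> C. trunc_power e s p \<noteq> 0} \<subseteq> C"
    using depth_pos_iff e by (force dest!: subsetD)
  show "compact (closure {p \<in> C. trunc_power e s p \<noteq> 0})"
    unfolding compact_closure by (rule bounded_subset[OF bounded]) auto
  have "e powr s < depth o' powr s" using e s o by (intro powr_less_mono2) auto
  then show "\<exists>p\<in>C. trunc_power e s p \<noteq> 0"
    using o by (auto simp: trunc_power_def intro!: bexI[of _ o'])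
qed

text \<open>For \<open>h > 0\<close> the function at \<open>p + h *\<^sub>R v\<close> lies below
  \<open>((1 + h / t) * depth p) powr s - e powr s\<close>, with equality at \<open>h = 0\<close>,
  so its derivative there cannot exceed that of the comparison function.\<close>

lemma derivative_trunc_power_le:
  assumes e: "e > 0" and s: "s > 0" and p: "p \<in> C" "depth p \<ge> e" and t: "t > 0" "p - t *\<^sub>R v \<in> C"
    and D: "(trunc_power e s has_derivative D) (at p)"
  shows "D v \<le> s * depth p powr s / t"
proof (rule ccontr)
  assume *: "\<not> D v \<le> s * depth p powr s / t"
  have "((\<lambda>h. p + h *\<^sub>R v) has_derivative (\<lambda>h. h *\<^sub>R v)) (at (0::real))"
    by (auto intro!: derivative_eq_intros)
  then have "((\<lambda>h. trunc_power e s (p + h *\<^sub>R v)) has_derivative (\<lambda>h. D (h *\<^sub>R v))) (at 0)"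
    using D by (intro has_derivative_compose[of _ _ 0 UNIV "trunc_power e s" D]) auto
  moreover have "D (h *\<^sub>R v) = D v * h" for h :: real
    using has_derivative_linear[OF D] by (simp add: linear_cmul)
  ultimately have 1: "((\<lambda>h. trunc_power e s (p + h *\<^sub>R v)) has_real_derivative D v) (at 0)"
    by (simp add: has_field_derivative_def)
  have 2: "((\<lambda>h. ((1 + h / t) * depth p) powr s - e powr s) has_real_derivative s * depth p powr s / t) (at 0)"
    using t p e by (auto intro!: derivative_eq_intros simp: powr_diff)
  have "\<exists>d>0. \<forall>h>0. h < d \<longrightarrow>
      (((1 + (0 + h) / t) * depth p) powr s - e powr s) - trunc_power e s (p + (0 + h) *\<^sub>R v)
      < (((1 + 0 / t) * depth p) powr s - e powr s) - trunc_power e s (p + 0 *\<^sub>R v)"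
    using * by (intro DERIV_neg_dec_right[OF DERIV_diff[OF 2 1]]) simp
  then obtain d where d: "d > 0" and less: "\<And>h. 0 < h \<Longrightarrow> h < d \<Longrightarrow>
      (((1 + h / t) * depth p) powr s - e powr s) - trunc_power e s (p + h *\<^sub>R v)
      < (depth p powr s - e powr s) - trunc_power e s p"
    by auto
  define h where "h = d / 2"
  have h: "0 < h" "h < d" using d by (auto simp: h_def)
  have "max (depth (p + h *\<^sub>R v)) e \<le> (1 + h / t) * depth p"
  proof -
    have "e \<le> 1 * depth p" using p by simp
    also have "\<dots> \<le> (1 + h / t) * depth p" using h t depth_nonneg by (intro mult_right_mono) auto
    finally show ?thesis using depth_along_ray_le[OF p(1) t, of h] h by simp
  qed
  then have "max (depth (p + h *\<^sub>R v)) e powr s \<le> ((1 + h / t) * depth p) powr s"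
    using s e by (intro powr_mono2) auto
  then show False using less[OF h] p by (simp add: trunc_power_def max_absorb1)
qed

text \<open>Letting \<open>t\<close> increase to the exit times bounds \<open>D v\<close> by
  \<open>?K / b\<close> and \<open>- D v\<close> by \<open>?K / a\<close>. The absolute value is at
  most the sum of the two, which is \<open>2 * ?K\<close> times the Finsler norm.\<close>

lemma derivative_trunc_power_le_finsler:
  assumes e: "e > 0" and s: "s > 0" and p: "p \<in> C" "depth p \<ge> e"
    and D: "(trunc_power e s has_derivative D) (at p)"
  shows "\<bar>D v\<bar> \<le> 2 * s * depth p powr s * finsler C p v"
proof (cases "v = 0")
  case True
  then show ?thesis using has_derivative_linear[OF D] by (simp add: linear_0 finsler_def)
next
  case False
  let ?K = "s * depth p powr s"
  have K: "?K > 0" using s p e by simp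
  obtain a b where ab: "a > 0" "b > 0" "finsler C p v = (1 / a + 1 / b) / 2"
    "\<And>s. s \<ge> 0 \<Longrightarrow> p + s *\<^sub>R v \<in> C \<longleftrightarrow> s < a"
    "\<And>s. s \<ge> 0 \<Longrightarrow> p - s *\<^sub>R v \<in> C \<longleftrightarrow> s < b"
    using finsler_exit_times[OF p(1) False] by blast
  have bound: "D w \<le> ?K / c" if c: "c > 0" "\<And>t. t \<ge> 0 \<Longrightarrow> p - t *\<^sub>R w \<in> C \<longleftrightarrow> t < c" for w c
  proof (rule ccontr)
    assume *: "\<not> D w \<le> ?K / c"
    moreover have "?K / c > 0" using K c(1) by simp
    ultimately have "D w > 0" by linarith
    with * have "?K / D w < c" using c(1) by (simp add: field_simps)
    then obtain t where t: "?K / D w < t" "t < c" using dense by blast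
    moreover have "?K / D w > 0" using K \<open>D w > 0\<close> by simp
    ultimately have "t > 0" by linarith
    with t(1) \<open>D w > 0\<close> have "D w > ?K / t" by (simp add: field_simps)
    then show False
      using derivative_trunc_power_le[OF e s p _ _ D, of t w] c(2)[of t] t \<open>t > 0\<close> by simp
  qed
  have "D v \<le> ?K / b" using bound[of b v] ab by simp
  moreover have "D (- v) \<le> ?K / a" using bound[of a "- v"] ab by simp
  moreover have "D (- v) = - D v" using has_derivative_linear[OF D] by (simp add: linear_neg)
  moreover have "?K / a > 0" "?K / b > 0" using K ab by simp_all
  ultimately have "\<bar>D v\<bar> \<le> ?K / a + ?K / b" by linarith
  also have "\<dots> = 2 * s * depth p powr s * finsler C p v" unfolding ab(3) by (simp add: algebra_simps)
  finally show ?thesis .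
qed

lemma frechet_derivative_trunc_power_eq_0:
  assumes "depth p < e"
  shows "frechet_derivative (trunc_power e s) (at p) = (\<lambda>v. 0)"
proof -
  have "open (depth -` {..<e})" by (intro open_vimage continuous_on_depth) auto
  then have "(trunc_power e s has_derivative (\<lambda>v. 0)) (at p)"
  proof (rule has_derivative_transform_within_open[OF has_derivative_const])
    show "p \<in> depth -` {..<e}" using assms by simp
  qed (auto simp: trunc_power_def max_def)
  from frechet_derivative_at[OF this] show ?thesis by (rule sym)
qed

text \<open>Nonnegativity comes from \<open>v = 0\<close>; it allows the upper bound to be squared
  in the energy.\<close>

lemma dual_norm_trunc_power:
  assumes e: "e > 0" and s: "s > 0" and p: "p \<in> C" and diff: "trunc_power e s differentiable (at p)"
  shows "0 \<le> dual_norm C p (frechet_derivative (trunc_power e s) (at p))"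
    and "dual_norm C p (frechet_derivative (trunc_power e s) (at p))
      \<le> (if depth p < e then 0 else 2 * s * depth p powr s)"
proof -
  let ?D = "frechet_derivative (trunc_power e s) (at p)"
  have D: "(trunc_power e s has_derivative ?D) (at p)"
    using diff by (simp add: frechet_derivative_works)
  have D0: "?D 0 = 0" using has_derivative_linear[OF D] by (simp add: linear_0)
  have ne: "0 \<in> {\<bar>?D v\<bar> | v. finsler C p v \<le> 1}"
    using D0 by (auto simp: finsler_def intro!: exI[of _ 0])
  have bound: "\<bar>?D v\<bar> \<le> (if depth p < e then 0 else 2 * s * depth p powr s)"
    if "finsler C p v \<le> 1" for v
  proof (cases "depth p < e")
    case True
    then show ?thesis by (simp add: frechet_derivative_trunc_power_eq_0)
  next
    case False
    then have "\<bar>?D v\<bar> \<le> 2 * s * depth p powr s * finsler C p v"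
      by (intro derivative_trunc_power_le_finsler[OF e s p _ D]) auto
    also have "\<dots> \<le> 2 * s * depth p powr s * 1"
      using that s by (intro mult_left_mono) auto
    finally show ?thesis using False by simp
  qed
  show "0 \<le> dual_norm C p ?D"
    unfolding dual_norm_def using bound by (intro cSup_upper ne bdd_aboveI) blast
  show "dual_norm C p ?D \<le> (if depth p < e then 0 else 2 * s * depth p powr s)"
    unfolding dual_norm_def using ne bound by (intro cSup_least) blast+
qed

end

section \<open>Volume of the polar bodies\<close>

context bounded_open_convex
begin

definition polar_at :: "'a \<Rightarrow> 'a set" where
  "polar_at p = {y. \<forall>c\<in>C. y \<bullet> (c - p) \<le> 1}"

lemma polar_at_norm_le:
  assumes p: "p \<in> C" and y: "y \<in> polar_at p"
  shows "norm y \<le> 1 / depth p"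
proof (rule ccontr)
  assume *: "\<not> norm y \<le> 1 / depth p"
  have d: "depth p > 0" using p depth_pos_iff by simp
  then have "norm y > 0" using * by (smt (verit) zero_less_divide_1_iff)
  then have "1 / norm y < depth p" using * d by (simp add: field_simps)
  then obtain r where r: "1 / norm y < r" "r < depth p" using dense by blast
  moreover have "1 / norm y > 0" using \<open>norm y > 0\<close> by simp
  ultimately have "r > 0" by linarith
  have "norm ((r / norm y) *\<^sub>R y) = r" using \<open>norm y > 0\<close> \<open>r > 0\<close> by simp
  then have "p + (r / norm y) *\<^sub>R y \<in> C" using r ball_depth_subset[of p] by (auto simp: dist_norm subset_iff)
  then have "(r / norm y) * (y \<bullet> y) \<le> 1" using y by (force simp: polar_at_def)
  then have "r * norm y \<le> 1" using \<open>norm y > 0\<close> by (simp add: dot_square_norm power2_eq_square)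
  with r(1) \<open>norm y > 0\<close> show False by (simp add: field_simps)
qed

lemma closed_polar_at: "closed (polar_at p)"
proof -
  have "polar_at p = (\<Inter>c\<in>C. {y. (c - p) \<bullet> y \<le> 1})"
    by (auto simp: polar_at_def inner_commute)
  then show ?thesis by (auto intro!: closed_INT closed_halfspace_le)
qed

lemma bounded_polar_at: "p \<in> C \<Longrightarrow> bounded (polar_at p)"
  unfolding bounded_iff using polar_at_norm_le by blast

text \<open>The polar body thus contains a ball, so matrices with rows in it can have nonzero
  determinant.\<close>

lemma small_in_polar_at:
  assumes "p \<in> C" and "norm y \<le> 1 / diameter C"
  shows "y \<in> polar_at p"
  unfolding polar_at_def
proof (intro CollectI ballI)
  fix c assume c: "c \<in> C"
  have "y \<bullet> (c - p) \<le> norm y * norm (c - p)" by (rule norm_cauchy_schwarz)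
  also have "\<dots> \<le> 1 / diameter C * diameter C"
    using assms diameter_bounded_bound[OF bounded c, of p] diameter_pos
    by (intro mult_mono) (auto simp: dist_norm)
  finally show "y \<bullet> (c - p) \<le> 1" using diameter_pos by simp
qed

text \<open>One half of the bipolar theorem: the normal of a hyperplane separating
  \<open>p + w\<close> from \<open>C\<close>, rescaled to have inner product 1 with
  \<open>w\<close>, would lie in the polar body.\<close>

lemma in_C_if_polar_less:
  assumes p: "p \<in> C" and w: "\<And>y. y \<in> polar_at p \<Longrightarrow> y \<bullet> w < 1"
  shows "p + w \<in> C"
proof (rule ccontr)
  assume "p + w \<notin> C"
  then obtain a b where ab: "a \<noteq> 0" "\<forall>x\<in>C. a \<bullet> x \<le> b" "\<forall>x\<in>{p + w}. b \<le> a \<bullet> x"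
    using separating_hyperplane_sets[of C "{p + w}"] convex nonempty by auto
  \<comment> \<open>The inequality is strict because \<open>p\<close> is interior; this makes
    \<open>a \<bullet> w\<close> positive and the rescaling possible.\<close>
  have "a \<bullet> p < b"
  proof -
    obtain e where e: "e > 0" "cball p e \<subseteq> C" using open_C p open_contains_cball by blast
    have "norm ((e / norm a) *\<^sub>R a) = e" using ab(1) e by simp
    then have "p + (e / norm a) *\<^sub>R a \<in> C" using e by (auto simp: dist_norm subset_iff)
    then have "a \<bullet> (p + (e / norm a) *\<^sub>R a) \<le> b" using ab(2) by blast
    moreover have "(e / norm a) * (a \<bullet> a) > 0" using ab(1) e by simp
    ultimately show ?thesis by (simp add: inner_add_right)
  qed
  then have aw: "a \<bullet> w > 0" using ab(3) by (simp add: inner_add_right)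
  have "a /\<^sub>R (a \<bullet> w) \<in> polar_at p"
    unfolding polar_at_def
  proof (intro CollectI ballI)
    fix c assume "c \<in> C"
    then have "a \<bullet> (c - p) \<le> a \<bullet> w"
      using ab(2,3) by (fastforce simp: inner_add_right inner_diff_right)
    then show "(a /\<^sub>R (a \<bullet> w)) \<bullet> (c - p) \<le> 1" using aw by (simp add: field_simps)
  qed
  from w[OF this] aw show False by simp
qed

end

text \<open>The library version asks for a well-ordered index type, which is used only to compute the
  determinant of a shear.\<close>

lemma measure_linear_image_cart:
  fixes f :: "real^'n \<Rightarrow> real^'n"
  assumes "linear f"
  shows "\<forall>S\<in>lmeasurable. f ` S \<in> lmeasurable \<and> measure lebesgue (f ` S) = \<bar>det (matrix f)\<bar> * measure lebesgue S"
    (is "?P f")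
proof (rule induct_linear_elementary[OF assms])
  fix f g :: "real^'n \<Rightarrow> real^'n"
  assume "linear f" "linear g" "?P f" "?P g"
  then show "?P (f \<circ> g)"
    unfolding image_comp[symmetric] by (simp only: matrix_compose det_mul abs_mult mult.assoc) auto
next
  fix f :: "real^'n \<Rightarrow> real^'n" and i
  assume f: "linear f" "\<And>x. f x $ i = 0"
  have "\<not> surj f"
    using f(2) by (metis surj_def one_neq_zero vec_component)
  then have "\<not> inj f" using f(1) linear_injective_imp_surjective by blast
  moreover from this have "det (matrix f) = 0" using det_nz_iff_inj[OF f(1)] by blast
  ultimately show "?P f"
    using negligible_linear_singular_image[OF f(1)]
    by (simp add: negligible_imp_measurable negligible_imp_measure0)
next
  fix c :: "'n \<Rightarrow> real"
  show "?P (\<lambda>x. \<chi> i. c i * x $ i)"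
    by (simp add: measurable_stretch measure_stretch matrix_def axis_def det_diagonal)
next
  fix m n :: 'n
  assume "m \<noteq> n"
  let ?t = "Transposition.transpose m n"
  let ?h = "\<lambda>x::real^'n. \<chi> i. x $ ?t i"
  have lin: "linear ?h" by (rule linearI) (simp_all add: vec_eq_iff)
  \<comment> \<open>The swap is an involution, so its determinant squares to 1, which fixes the
    absolute value.\<close>
  have "matrix (?h \<circ> ?h) = mat 1" by (simp add: o_def matrix_id_mat_1[symmetric] id_def)
  then have "det (matrix ?h) * det (matrix ?h) = 1"
    using matrix_compose[OF lin lin] by (metis det_I det_mul)
  then have det: "\<bar>det (matrix ?h)\<bar> = 1" by (simp add: abs_square_eq_1[symmetric] power2_eq_square)
  have box: "?h ` cbox a b = cbox (?h a) (?h b)" for a b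
  proof (intro set_eqI iffI)
    fix y assume y: "y \<in> cbox (?h a) (?h b)"
    have "?h y \<in> cbox a b" using y by (auto simp: mem_box_cart) (metis transpose_involutory)+
    moreover have "y = ?h (?h y)" by (simp add: vec_eq_iff)
    ultimately show "y \<in> ?h ` cbox a b" by blast
  qed (auto simp: mem_box_cart)
  have "measure lebesgue (?h ` cbox a b) = 1 * measure lebesgue (cbox a b)" for a b
  proof (cases "cbox a b = {}")
    case False
    then have "cbox (?h a) (?h b) \<noteq> {}" using box by (metis image_is_empty)
    moreover have "(\<Prod>i\<in>UNIV. b $ ?t i - a $ ?t i) = (\<Prod>i\<in>UNIV. b $ i - a $ i)"
      using prod.reindex_bij_betw[OF permutes_imp_bij[OF permutes_swap_id[of m UNIV n]], of "\<lambda>i. b $ i - a $ i"]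
      by simp
    ultimately show ?thesis using False unfolding box by (simp add: content_cbox_cart)
  qed simp
  then show "?P ?h" using measure_linear_sufficient[OF lin] det by (metis mult_1)
next
  fix m n :: 'n
  assume "m \<noteq> n"
  let ?h = "\<lambda>x::real^'n. \<chi> i. if i = m then x $ m + x $ n else x $ i"
  have lin: "linear ?h" by (rule linearI) (auto simp: algebra_simps vec_eq_iff)
  have "matrix ?h = (\<chi> k. if k = m then row m (mat 1) + 1 *s row n (mat 1) else row k (mat 1))"
    by (auto simp: matrix_def row_def mat_def axis_def vec_eq_iff)
  then have det: "det (matrix ?h) = 1"
    using det_row_operation[OF \<open>m \<noteq> n\<close>, of "mat 1" 1] by simp
  have box: "measure lebesgue (?h ` cbox a b) = 1 * measure lebesgue (cbox a b)" for a b
  proof (cases "cbox a b = {}")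
    case False
    \<comment> \<open>Boxes are moved to the origin, where the volume of a sheared interval is
      known.\<close>
    have shift: "cbox a b = (+) a ` cbox 0 (b - a)"
      using cbox_translation[of a 0 "b - a"] by simp
    have "?h ` cbox a b = (+) (?h a) ` ?h ` cbox 0 (b - a)"
      unfolding shift image_image using linear_add[OF lin] by simp
    moreover have "measure lebesgue (?h ` cbox 0 (b - a)) = measure lebesgue (cbox 0 (b - a))"
      using False shift by (intro measure_shear_interval[OF \<open>m \<noteq> n\<close>]) auto
    ultimately show ?thesis using shift by (simp only: measure_translation mult_1)
  qed simp
  show "?P ?h"
  proof
    fix S :: "(real^'n) set"
    assume "S \<in> lmeasurable"
    from measure_linear_sufficient[OF lin this box]
    show "?h ` S \<in> lmeasurable \<and> measure lebesgue (?h ` S) = \<bar>det (matrix ?h)\<bar> * measure lebesgue S"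
      unfolding det by simp
  qed
qed

text \<open>Choosing rows \<open>A $ i\<close> in the polar body with maximal \<open>\<bar>det A\<bar>\<close> traps the polar body, by Cramer's
  rule, in the parallelepiped they span; dually, the ball of the Finsler norm contains the dual
  parallelepiped.\<close>

lemma ex_max_det_rows:
  fixes P :: "(real^'n) set"
  assumes "compact P" and r: "r > 0" "\<And>y. norm y \<le> r \<Longrightarrow> y \<in> P"
  obtains A :: "real^'n^'n" where "\<And>i. A $ i \<in> P" "det A \<noteq> 0"
    "\<And>y. y \<in> P \<Longrightarrow> \<exists>x. y = transpose A *v x \<and> (\<forall>k. \<bar>x $ k\<bar> \<le> 1)"
proof -
  define S where "S = {A :: real^'n^'n. \<forall>i. A $ i \<in> P}"
  obtain B where B: "\<And>y. y \<in> P \<Longrightarrow> norm y \<le> B"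
    using compact_imp_bounded[OF assms(1)] unfolding bounded_iff by blast
  have "norm A \<le> (\<Sum>i\<in>(UNIV::'n set). B)" if "A \<in> S" for A
  proof -
    have "norm A \<le> (\<Sum>i\<in>UNIV. norm (A $ i))"
      unfolding norm_vec_def by (rule L2_set_le_sum) simp
    also have "\<dots> \<le> (\<Sum>i\<in>(UNIV::'n set). B)" using that B by (intro sum_mono) (auto simp: S_def)
    finally show ?thesis .
  qed
  then have "bounded S" unfolding bounded_iff by blast
  moreover have "closed S"
  proof -
    have "S = (\<Inter>i. (\<lambda>A. A $ i) -` P)" by (auto simp: S_def)
    moreover have "closed ((\<lambda>A :: real^'n^'n. A $ i) -` P)" for i
      using compact_imp_closed[OF assms(1)] by (intro closed_vimage continuous_intros)
    ultimately show ?thesis by auto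
  qed
  ultimately have "compact S" by (simp add: compact_eq_bounded_closed)
  have mat_S: "mat r \<in> S"
  proof -
    have "(mat r :: real^'n^'n) $ i = axis i r" for i
      by (simp add: mat_def axis_def vec_eq_iff)
    moreover have "axis i r = r *\<^sub>R axis i 1" for i :: 'n
      by (simp add: axis_def vec_eq_iff)
    ultimately show ?thesis using r by (simp add: S_def)
  qed
  have "continuous_on S (\<lambda>A. \<bar>det A\<bar>)"
    unfolding det_def by (intro continuous_intros)
  from continuous_attains_sup[OF \<open>compact S\<close> _ this] mat_S
  obtain A where A: "A \<in> S" "\<And>A'. A' \<in> S \<Longrightarrow> \<bar>det A'\<bar> \<le> \<bar>det A\<bar>" by blast
  have "det (mat r :: real^'n^'n) = r ^ CARD('n)"
    by (simp add: det_diagonal mat_def)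
  then have detA: "det A \<noteq> 0" using A(2)[OF mat_S] zero_less_power[OF r(1), of "CARD('n)"] by auto
  have "\<exists>x. y = transpose A *v x \<and> (\<forall>k. \<bar>x $ k\<bar> \<le> 1)" if y: "y \<in> P" for y
  proof -
    have "invertible (transpose A)" using detA by (simp add: invertible_det_nz)
    then obtain x where x: "y = transpose A *v x"
      by (metis invertible_def matrix_vector_mul_assoc matrix_vector_mul_lid)
    have "\<bar>x $ k\<bar> \<le> 1" for k
    proof -
      \<comment> \<open>Row \<open>k\<close> of \<open>A\<close> is replaced by \<open>y\<close>. By
        Cramer's rule this multiplies the determinant by \<open>x $ k\<close>, and maximality gives
        \<open>\<bar>x $ k\<bar> \<le> 1\<close>.\<close>
      let ?A = "\<chi> i. if i = k then y else A $ i"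
      let ?M = "\<chi> i j. if j = k then (transpose A *v x) $ i else transpose A $ i $ j"
      have "transpose ?M = ?A"
        unfolding x[symmetric] by (simp add: transpose_def vec_eq_iff)
      then have "det ?A = det ?M" using det_transpose[of ?M] by simp
      also have "\<dots> = x $ k * det A" by (simp only: cramer_lemma det_transpose)
      finally have "det ?A = x $ k * det A" .
      moreover have "?A \<in> S" using A(1) y by (auto simp: S_def)
      ultimately have "\<bar>x $ k\<bar> * \<bar>det A\<bar> \<le> 1 * \<bar>det A\<bar>" using A(2)[of ?A] by (simp add: abs_mult)
      then show ?thesis using detA by simp
    qed
    with x show ?thesis by blast
  qed
  with A(1) detA show thesis by (intro that[of A]) (auto simp: S_def)
qed

lemma measure_cube_cart:
  fixes a b :: real
  assumes "a \<le> b"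
  shows "measure lborel (box (\<chi> i. a) (\<chi> i. b) :: (real^'n) set) = (b - a) ^ CARD('n)"
proof -
  have le: "\<forall>k\<in>Basis. (\<chi> i. a) \<bullet> k \<le> ((\<chi> i. b) :: real^'n) \<bullet> k"
    using assms by (auto simp: Basis_vec_def inner_axis)
  then have "measure lborel (box (\<chi> i. a) (\<chi> i. b) :: (real^'n) set) = measure lborel (cbox (\<chi> i. a) (\<chi> i. b) :: (real^'n) set)"
    by simp
  also have "\<dots> = (b - a) ^ CARD('n)"
    using assms by (subst content_cbox_cart) (auto simp: interval_ne_empty_cart)
  finally show ?thesis .
qed

text \<open>A reverse Santalo inequality with a crude constant. A parallelepiped \<open>W\<close> of
  volume \<open>(2 / N) ^ CARD('n) / \<bar>det A\<bar>\<close> lies in the Finsler ball, and one of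
  volume \<open>\<bar>det A\<bar> * (1 / N) ^ CARD('n)\<close> in the polar body; the determinant
  cancels in the product.\<close>

lemma finsler_ball_polar_volume:
  fixes C :: "(real^'n) set"
  assumes "bounded_open_convex C" and p: "p \<in> C"
  defines "N \<equiv> real CARD('n)"
  shows "(2 / N) ^ CARD('n) * (1 / N) ^ CARD('n) \<le>
    measure lborel {v. finsler C p v < 1} * measure lborel (bounded_open_convex.polar_at C p)"
proof -
  interpret bounded_open_convex C by fact
  have N: "N > 0" by (simp add: N_def)
  let ?P = "polar_at p" and ?F = "{v. finsler C p v < 1}"
  have cP: "compact ?P" using closed_polar_at bounded_polar_at[OF p] by (simp add: compact_eq_bounded_closed)
  obtain A :: "real^'n^'n" where A: "\<And>i. A $ i \<in> ?P" "det A \<noteq> 0"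
    "\<And>y. y \<in> ?P \<Longrightarrow> \<exists>x. y = transpose A *v x \<and> (\<forall>k. \<bar>x $ k\<bar> \<le> 1)"
    using ex_max_det_rows[OF cP, of "1 / diameter C"] small_in_polar_at[OF p] diameter_pos by auto
  \<comment> \<open>With the bound \<open>1 / N\<close>, the \<open>N\<close> terms of the inner
    product with a polar vector sum to less than 1.\<close>
  define W where "W = {w. \<forall>i. \<bar>(A *v w) $ i\<bar> < 1 / N}"
  have inner_A: "(transpose A *v x) \<bullet> w = (\<Sum>k\<in>UNIV. x $ k * (A *v w) $ k)" for x w
    unfolding transpose_matrix_vector dot_lmul_matrix by (simp add: inner_vec_def)
  have W_C: "p + w \<in> C" if "w \<in> W" for w
  proof (rule in_C_if_polar_less[OF p])
    fix y assume "y \<in> ?P"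
    then obtain x where x: "y = transpose A *v x" "\<And>k. \<bar>x $ k\<bar> \<le> 1" using A(3) by blast
    have "y \<bullet> w \<le> (\<Sum>k\<in>UNIV. \<bar>x $ k\<bar> * \<bar>(A *v w) $ k\<bar>)"
      unfolding x(1) inner_A by (intro sum_mono) (simp flip: abs_mult)
    also have "\<dots> < (\<Sum>k\<in>(UNIV::'n set). 1 / N)"
    proof (rule sum_strict_mono)
      fix k
      have "\<bar>x $ k\<bar> * \<bar>(A *v w) $ k\<bar> \<le> 1 * \<bar>(A *v w) $ k\<bar>" using x(2) by (intro mult_right_mono) auto
      also have "\<dots> < 1 / N" using that by (simp add: W_def)
      finally show "\<bar>x $ k\<bar> * \<bar>(A *v w) $ k\<bar> < 1 / N" .
    qed auto
    also have "\<dots> = 1" by (simp add: N_def)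
    finally show "y \<bullet> w < 1" .
  qed
  have "- w \<in> W" if "w \<in> W" for w
    using that by (simp add: W_def linear_neg[OF matrix_vector_mul_linear])
  then have WF: "W \<subseteq> ?F" using W_C p finsler_less_1I by force
  have W_vimage: "W = (*v) A -` box (\<chi> i. - (1 / N)) (\<chi> i. 1 / N)"
    by (auto simp: W_def mem_box_cart abs_less_iff minus_less_iff)
  then have "open W"
    by (auto intro!: open_vimage linear_continuous_on simp: linear_conv_bounded_linear[symmetric])
  have "bounded W" using WF finsler_ball_bounded[OF p] bounded_ball bounded_subset by blast
  have W_meas: "W \<in> lmeasurable" using \<open>open W\<close> \<open>bounded W\<close> by (simp add: lmeasurable_open)
  obtain B where "A ** B = mat 1" using A(2) by (auto simp: invertible_det_nz[symmetric] invertible_def)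
  then have "surj ((*v) A)"
    by (intro surjI[of _ "(*v) B"]) (simp add: matrix_vector_mul_assoc)
  then have "(*v) A ` W = box (\<chi> i. - (1 / N)) (\<chi> i. 1 / N)"
    unfolding W_vimage by (rule surj_image_vimage_eq)
  then have "measure lborel (box (\<chi> i. - (1 / N)) (\<chi> i. 1 / N) :: (real^'n) set) = \<bar>det A\<bar> * measure lborel W"
    using measure_linear_image_cart[OF matrix_vector_mul_linear[of A]] W_meas \<open>open W\<close>
    by (auto simp: matrix_of_matrix_vector_mul)
  moreover have "measure lborel (box (\<chi> i. - (1 / N)) (\<chi> i. 1 / N) :: (real^'n) set) = (2 / N) ^ CARD('n)"
    using N by (simp add: measure_cube_cart)
  ultimately have W_vol: "(2 / N) ^ CARD('n) = \<bar>det A\<bar> * measure lborel W" by simp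
  \<comment> \<open>The definition of \<open>polar_at\<close> bounds inner products from above only,
    so the rows of \<open>A\<close> are combined with nonnegative coefficients.\<close>
  let ?Q = "box (\<chi> i. 0) (\<chi> i. 1 / N) :: (real^'n) set"
  have QP: "(*v) (transpose A) ` ?Q \<subseteq> ?P"
  proof safe
    fix x assume x: "x \<in> ?Q"
    show "transpose A *v x \<in> ?P"
      unfolding polar_at_def
    proof (intro CollectI ballI)
      fix c assume c: "c \<in> C"
      have "(transpose A *v x) \<bullet> (c - p) = (\<Sum>k\<in>UNIV. x $ k * (A *v (c - p)) $ k)" by (rule inner_A)
      also have "\<dots> \<le> (\<Sum>k\<in>(UNIV::'n set). 1 / N * 1)"
      proof (rule sum_mono)
        fix k
        have "(A *v (c - p)) $ k = A $ k \<bullet> (c - p)" by (simp add: matrix_vector_mul_component)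
        then have "(A *v (c - p)) $ k \<le> 1" using A(1)[of k] c by (simp add: polar_at_def)
        then have "x $ k * (A *v (c - p)) $ k \<le> x $ k * 1"
          using x by (intro mult_left_mono) (auto simp: mem_box_cart less_imp_le)
        also have "\<dots> \<le> 1 / N * 1" using x by (simp add: mem_box_cart less_imp_le)
        finally show "x $ k * (A *v (c - p)) $ k \<le> 1 / N * 1" .
      qed
      also have "\<dots> = 1" by (simp add: N_def)
      finally show "(transpose A *v x) \<bullet> (c - p) \<le> 1" .
    qed
  qed
  have PF: "?P \<in> lmeasurable" using cP by (rule lmeasurable_compact)
  have "?Q \<in> lmeasurable" by simp
  then have Q_im: "(*v) (transpose A) ` ?Q \<in> lmeasurable"
    "measure lebesgue ((*v) (transpose A) ` ?Q) = \<bar>det A\<bar> * measure lebesgue ?Q"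
    using measure_linear_image_cart[OF matrix_vector_mul_linear[of "transpose A"],
        unfolded matrix_of_matrix_vector_mul det_transpose]
    by (auto simp del: transpose_matrix_vector)
  have "measure lborel ?Q = (1 / N) ^ CARD('n)"
    using N by (simp add: measure_cube_cart)
  then have "\<bar>det A\<bar> * (1 / N) ^ CARD('n) = measure lebesgue ((*v) (transpose A) ` ?Q)"
    using Q_im(2) by simp
  also have "\<dots> \<le> measure lebesgue ?P"
    using Q_im(1) PF QP by (intro measure_mono_fmeasurable) auto
  also have "\<dots> = measure lborel ?P"
    using closed_polar_at by (simp add: measure_completion borel_closed)
  finally have P_vol: "\<bar>det A\<bar> * (1 / N) ^ CARD('n) \<le> measure lborel ?P" .
  have "open ?F"
  proof -
    have "?F = Pair p -` {(p, v). p \<in> C \<and> finsler C p v < 1}" using p by auto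
    then show ?thesis
      by (simp only:) (intro open_vimage open_finsler_balls continuous_intros)
  qed
  moreover have "bounded ?F" using finsler_ball_bounded[OF p] bounded_ball bounded_subset by blast
  ultimately have "?F \<in> lmeasurable" by (simp add: lmeasurable_open)
  then have "measure lebesgue W \<le> measure lebesgue ?F"
    using WF W_meas by (intro measure_mono_fmeasurable) auto
  then have "measure lborel W \<le> measure lborel ?F" using \<open>open W\<close> \<open>open ?F\<close> by simp
  then have "measure lborel W * (\<bar>det A\<bar> * (1 / N) ^ CARD('n)) \<le> measure lborel ?F * measure lborel ?P"
    using P_vol N by (intro mult_mono) (auto intro!: mult_nonneg_nonneg)
  then show ?thesis unfolding W_vol by (simp add: mult_ac)
qed

section \<open>Integrating the polar volume over shells\<close>

lemma nn_integral_lborel_translate: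
  fixes f :: "'a::euclidean_space \<Rightarrow> ennreal"
  assumes [measurable]: "f \<in> borel_measurable borel"
  shows "(\<integral>\<^sup>+x. f (c + x) \<partial>lborel) = (\<integral>\<^sup>+x. f x \<partial>lborel)"
proof -
  have "(\<integral>\<^sup>+x. f x \<partial>lborel) = (\<integral>\<^sup>+x. f x \<partial>distr lborel borel ((+) c))"
    by (simp only: lborel_distr_plus)
  also have "\<dots> = (\<integral>\<^sup>+x. f (c + x) \<partial>lborel)"
    by (subst nn_integral_distr) auto
  finally show ?thesis ..
qed

lemma emeasure_le_ball_if_diam:
  fixes S :: "'a::euclidean_space set"
  assumes "\<And>x y. x \<in> S \<Longrightarrow> y \<in> S \<Longrightarrow> dist x y \<le> r" and "r \<ge> 0"
  shows "emeasure lborel S \<le> ennreal (unit_ball_vol DIM('a) * r ^ DIM('a))"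
proof (cases "S = {}")
  case False
  then obtain x where "x \<in> S" by blast
  then have "emeasure lborel S \<le> emeasure lborel (cball x r)"
    using assms by (intro emeasure_mono) auto
  then show ?thesis by (simp add: emeasure_cball assms)
qed simp

section \<open>Thin shells near the boundary\<close>

context bounded_open_convex
begin

text \<open>Translates of the shell by multiples \<open>s\<close> of the inward vector \<open>o' - p\<^sub>0\<close> overlap only for
  values of \<open>s\<close> within \<open>4 t / depth o'\<close> of each other, because the depth increases linearly inwards.\<close>

lemma shell_inter_ball_volume:
  assumes o: "o' \<in> C" and p0: "p0 \<in> C" and t: "0 < t" "t \<le> depth o' / 4"
    and r: "0 < r" "r \<le> depth o' / 2" "r \<le> 1"
  defines "S \<equiv> {p \<in> cball p0 r. t < depth p \<and> depth p \<le> 2 * t}"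
  shows "ennreal r * emeasure lborel S \<le>
    ennreal (unit_ball_vol DIM('a) * (r * (1 + diameter C)) ^ DIM('a) * (8 * t / depth o'))"
proof -
  define w where "w = o' - p0"
  define a where "a = depth o'"
  have a: "a > 0" using t by (simp add: a_def)
  have w: "norm w \<le> diameter C" using diameter_bounded_bound[OF bounded o p0] by (simp add: w_def dist_norm)
  have S_borel [measurable]: "S \<in> sets borel"
  proof -
    have "S = cball p0 r \<inter> (depth -` {t<..} \<inter> depth -` {..2 * t})" by (auto simp: S_def)
    moreover have "open (depth -` {t<..})" "closed (depth -` {..2 * t})"
      by (auto intro!: open_vimage closed_vimage continuous_on_depth)
    ultimately show ?thesis by auto
  qed
  have close: "\<bar>s' - s\<bar> \<le> 4 * t / a"
    if s: "s \<in> {0..r}" "s' \<in> {0..r}" "x - s *\<^sub>R w \<in> S" "x - s' *\<^sub>R w \<in> S" for x s s'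
  proof -
    have *: "s' - s \<le> 4 * t / a" if s: "s \<in> {0..r}" "s' \<in> {0..r}" "x - s *\<^sub>R w \<in> S" "x - s' *\<^sub>R w \<in> S"
      "s \<le> s'" for s s'
    proof -
      define d where "d = s' - s"
      define p' where "p' = x - s' *\<^sub>R w"
      have d: "0 \<le> d" "d \<le> 1" using s r by (auto simp: d_def)
      have p': "p' \<in> C" "depth p' > t" "dist p0 p' \<le> r"
        using s(4) t by (auto simp: S_def p'_def simp flip: depth_pos_iff)
      \<comment> \<open>The point \<open>p' + w\<close> is \<open>o'\<close> translated by
        \<open>p' - p0\<close>, hence of depth at least \<open>a / 2\<close>. Concavity from
        \<open>p'\<close> towards it gives \<open>(1 - d) * t + d * (a / 2) \<le> 2 * t\<close>, and
        \<open>t \<le> a / 4\<close> then leaves \<open>d * a \<le> 4 * t\<close>.\<close>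
      have "dist (p' + w) o' \<le> a / 2" using p'(3) r by (simp add: w_def dist_norm a_def norm_minus_commute)
      then have dw: "depth (p' + w) \<ge> a / 2" using depth_diff_le[of "p' + w" o'] by (simp add: a_def abs_le_iff)
      then have "p' + w \<in> C" using a by (simp flip: depth_pos_iff)
      then have "(1 - d) * depth p' + d * depth (p' + w) \<le> depth ((1 - d) *\<^sub>R p' + d *\<^sub>R (p' + w))"
        using p' d by (intro depth_concave)
      also have "(1 - d) *\<^sub>R p' + d *\<^sub>R (p' + w) = x - s *\<^sub>R w"
        by (simp add: p'_def d_def algebra_simps)
      also have "depth (x - s *\<^sub>R w) \<le> 2 * t" using s(3) by (simp add: S_def)
      finally have "(1 - d) * depth p' + d * depth (p' + w) \<le> 2 * t" .
      moreover have "(1 - d) * t \<le> (1 - d) * depth p'" "d * (a / 2) \<le> d * depth (p' + w)"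
        using d p' dw by (intro mult_left_mono; simp)+
      moreover have "d * t \<le> d * (a / 4)" using d t by (intro mult_left_mono) (auto simp: a_def)
      ultimately have "d * a \<le> 4 * t" by (simp add: algebra_simps)
      then show ?thesis using a by (simp add: d_def field_simps)
    qed
    from *[of s s'] *[of s' s] s show ?thesis by (cases "s \<le> s'") auto
  qed
  let ?B = "cball p0 (r * (1 + diameter C))"
  let ?f = "\<lambda>s x. indicator {0..r} s * indicator S (x - s *\<^sub>R w) :: ennreal"
  have meas: "case_prod ?f \<in> borel_measurable (lborel \<Otimes>\<^sub>M lborel)"
    by measurable
  \<comment> \<open>The pairs \<open>(s, x)\<close> with \<open>x - s *\<^sub>R w \<in> S\<close>
    are measured in both orders: the slice at \<open>s\<close> is a translate of \<open>S\<close>,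
    while the slice at \<open>x\<close> is a short set of parameters, empty unless \<open>x\<close>
    lies in \<open>?B\<close>.\<close>
  have "ennreal r * emeasure lborel S = (\<integral>\<^sup>+s. indicator {0..r} s * emeasure lborel S \<partial>lborel)"
    using r by (simp add: nn_integral_multc)
  also have "\<dots> = (\<integral>\<^sup>+s. (\<integral>\<^sup>+x. ?f s x \<partial>lborel) \<partial>lborel)"
  proof (rule nn_integral_cong)
    fix s :: real
    have "(\<integral>\<^sup>+x. indicator S (x - s *\<^sub>R w) \<partial>lborel) = emeasure lborel S"
      using nn_integral_lborel_translate[of "indicator S" "- (s *\<^sub>R w)"] by simp
    then show "indicator {0..r} s * emeasure lborel S = (\<integral>\<^sup>+x. ?f s x \<partial>lborel)"
      by (simp add: nn_integral_cmult)
  qed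
  also have "\<dots> = (\<integral>\<^sup>+x. (\<integral>\<^sup>+s. ?f s x \<partial>lborel) \<partial>lborel)"
    by (rule lborel_pair.Fubini'[OF meas, symmetric])
  also have "\<dots> \<le> (\<integral>\<^sup>+x. indicator ?B x * ennreal (8 * t / a) \<partial>lborel)"
  proof (rule nn_integral_mono)
    fix x :: 'a
    let ?T = "{s \<in> {0..r}. x - s *\<^sub>R w \<in> S}"
    have "(\<integral>\<^sup>+s. ?f s x \<partial>lborel) = (\<integral>\<^sup>+s. indicator ?T s \<partial>lborel)"
      by (intro nn_integral_cong) (auto simp: indicator_def)
    also have "\<dots> = emeasure lborel ?T" by (intro nn_integral_indicator) measurable
    also have "\<dots> \<le> indicator ?B x * ennreal (8 * t / a)"
    proof (cases "?T = {}")
      case True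
      show ?thesis unfolding True by simp
    next
      case False
      then obtain s where s: "s \<in> {0..r}" "x - s *\<^sub>R w \<in> S" by auto
      have "dist p0 x \<le> norm (p0 - (x - s *\<^sub>R w)) + norm (s *\<^sub>R w)"
        unfolding dist_norm using norm_triangle_ineq4[of "p0 - (x - s *\<^sub>R w)" "s *\<^sub>R w"] by simp
      also have "\<dots> \<le> r + r * diameter C"
        using s w r by (intro add_mono) (auto simp: S_def dist_norm intro!: mult_mono)
      finally have "x \<in> ?B" by (simp add: algebra_simps)
      \<comment> \<open>A set of reals of diameter at most \<open>4 * t / a\<close> fits into an
        interval of that radius, whence the factor 8.\<close>
      moreover have "emeasure lborel ?T \<le> ennreal (unit_ball_vol DIM(real) * (4 * t / a) ^ DIM(real))"
        using close a t by (intro emeasure_le_ball_if_diam) (auto simp: dist_real_def)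
      ultimately show ?thesis by simp
    qed
    finally show "(\<integral>\<^sup>+s. ?f s x \<partial>lborel) \<le> indicator ?B x * ennreal (8 * t / a)" .
  qed
  also have "\<dots> = emeasure lborel ?B * ennreal (8 * t / a)"
    by (subst nn_integral_multc) (auto intro!: borel_measurable_indicator)
  also have "\<dots> = ennreal (unit_ball_vol DIM('a) * (r * (1 + diameter C)) ^ DIM('a) * (8 * t / a))"
    using r diameter_pos t a by (simp add: emeasure_cball ennreal_mult[symmetric])
  finally show ?thesis by (simp add: a_def)
qed

end

section \<open>Polar volume in shells and its dyadic sum\<close>

context bounded_open_convex
begin

lemma depth_borel_measurable [measurable]: "depth \<in> borel_measurable borel"
  by (rule borel_measurable_continuous_onI[OF continuous_on_depth])

text \<open>Closedness of the graph makes the volume of \<open>polar_at p\<close> measurable in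
  \<open>p\<close> and justifies the exchange of integrals below.\<close>

lemma closed_polar_graph: "closed {(p, y). y \<in> polar_at p}"
proof -
  have "{(p, y). y \<in> polar_at p} = (\<Inter>c\<in>C. {z. snd z \<bullet> (c - fst z) \<le> 1})"
    by (auto simp: polar_at_def)
  moreover have "closed {z :: 'a \<times> 'a. snd z \<bullet> (c - fst z) \<le> 1}" for c
    by (intro closed_Collect_le continuous_intros)
  ultimately show ?thesis by auto
qed

lemma emeasure_polar_at_measurable [measurable]:
  "(\<lambda>p. emeasure lborel (polar_at p)) \<in> borel_measurable borel"
proof -
  have "(\<lambda>p. emeasure lborel (Pair p -` {(p, y). y \<in> polar_at p})) \<in> borel_measurable lborel"
    using borel_closed[OF closed_polar_graph]
    by (intro lborel.measurable_emeasure_Pair) (simp only: lborel_prod sets_lborel)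
  then show ?thesis by (simp add: vimage_def)
qed

text \<open>If \<open>y\<close> and \<open>y'\<close> lie in the polar bodies at \<open>p\<close> and \<open>p'\<close>, then \<open>(y - y') \<bullet> (p - p') \<ge> - 2\<close>: the
  polar bodies form an almost monotone relation. Substituting \<open>y = c - p / t\<close> confines \<open>p\<close>, for fixed
  \<open>c\<close>, to a set of diameter \<open>sqrt (2 * t)\<close>.\<close>

lemma polar_at_slice_diam:
  assumes t: "t > 0" and p: "p \<in> C" "p' \<in> C"
    and y: "c - p /\<^sub>R t \<in> polar_at p" "c - p' /\<^sub>R t \<in> polar_at p'"
  shows "dist p p' \<le> sqrt (2 * t)"
proof -
  have "(c - p /\<^sub>R t) \<bullet> (p' - p) \<le> 1" "(c - p' /\<^sub>R t) \<bullet> (p - p') \<le> 1"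
    using y p by (auto simp: polar_at_def)
  then have "(c - p /\<^sub>R t) \<bullet> (p' - p) + (c - p' /\<^sub>R t) \<bullet> (p - p') \<le> 2" by linarith
  moreover have "(c - p /\<^sub>R t) \<bullet> (p' - p) + (c - p' /\<^sub>R t) \<bullet> (p - p') = inverse t * ((p - p') \<bullet> (p - p'))"
    by (simp add: inner_diff_left inner_diff_right algebra_simps inner_commute)
  ultimately have "inverse t * (dist p p')\<^sup>2 \<le> 2" by (simp add: dist_norm power2_norm_eq_inner)
  then have "(dist p p')\<^sup>2 \<le> 2 * t" using t by (simp add: field_simps)
  then show ?thesis by (rule real_le_rsqrt)
qed

lemma shell_polar_integral_le:
  fixes t :: real
  defines "r \<equiv> sqrt (2 * t)" and "n \<equiv> DIM('a)"
  assumes o: "o' \<in> C" and t: "0 < t" "t \<le> depth o' / 4" and r: "r \<le> depth o' / 2" "r \<le> 1"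
    and B: "\<And>p. p \<in> C \<Longrightarrow> norm p \<le> B" "B \<ge> 0"
  shows "(\<integral>\<^sup>+p. indicator {p. t < depth p \<and> depth p \<le> 2 * t} p * emeasure lborel (polar_at p) \<partial>lborel) \<le>
    ennreal (unit_ball_vol n * ((1 + B) / t) ^ n *
      (unit_ball_vol n * (r * (1 + diameter C)) ^ n * (8 * t / depth o') / r))"
proof -
  define S where "S = {p. t < depth p \<and> depth p \<le> 2 * t}"
  define m where "m = unit_ball_vol n * (r * (1 + diameter C)) ^ n * (8 * t / depth o')"
  have r0: "r > 0" using t by (simp add: r_def)
  have m0: "m \<ge> 0" using t r0 diameter_pos by (simp add: m_def)
  have S_borel [measurable]: "S \<in> sets borel" unfolding S_def by measurable
  have SC: "p \<in> C" if "p \<in> S" for p using that t by (simp add: S_def flip: depth_pos_iff)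
  let ?G = "{(p, y). y \<in> polar_at p} :: ('a \<times> 'a) set"
  \<comment> \<open>The second argument will be \<open>c - p /\<^sub>R t\<close>: for each
    \<open>p\<close> this is a translation in \<open>c\<close>, so integrating over \<open>c\<close>
    still gives the volume of the polar body.\<close>
  let ?f = "\<lambda>p y. indicator S p * indicator ?G (p, y) :: ennreal"
  have G [measurable]: "?G \<in> sets (borel \<Otimes>\<^sub>M borel)"
    using borel_closed[OF closed_polar_graph] by (simp only: borel_prod)
  have "(\<integral>\<^sup>+p. indicator S p * emeasure lborel (polar_at p) \<partial>lborel)
      = (\<integral>\<^sup>+p. (\<integral>\<^sup>+c. ?f p (c - p /\<^sub>R t) \<partial>lborel) \<partial>lborel)"
  proof (rule nn_integral_cong)
    fix p :: 'a
    have [measurable]: "polar_at p \<in> sets borel" by (simp add: borel_closed closed_polar_at)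
    have "emeasure lborel (polar_at p) = (\<integral>\<^sup>+c. indicator (polar_at p) (- (p /\<^sub>R t) + c) \<partial>lborel)"
      by (subst nn_integral_lborel_translate) auto
    also have "\<dots> = (\<integral>\<^sup>+c. indicator ?G (p, c - p /\<^sub>R t) \<partial>lborel)"
      by (intro nn_integral_cong) (auto simp: indicator_def)
    finally have e: "emeasure lborel (polar_at p) = (\<integral>\<^sup>+c. indicator ?G (p, c - p /\<^sub>R t) \<partial>lborel)" .
    show "indicator S p * emeasure lborel (polar_at p) = (\<integral>\<^sup>+c. ?f p (c - p /\<^sub>R t) \<partial>lborel)"
      unfolding e by (subst nn_integral_cmult) auto
  qed
  also have "\<dots> = (\<integral>\<^sup>+c. (\<integral>\<^sup>+p. ?f p (c - p /\<^sub>R t) \<partial>lborel) \<partial>lborel)"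
  proof (rule lborel_pair.Fubini'[symmetric])
    show "(\<lambda>(p, c). ?f p (c - p /\<^sub>R t)) \<in> borel_measurable (lborel \<Otimes>\<^sub>M lborel)"
      by measurable
  qed
  also have "\<dots> \<le> (\<integral>\<^sup>+c. indicator (cball (0::'a) ((1 + B) / t)) c * ennreal (m / r) \<partial>lborel)"
  proof (rule nn_integral_mono)
    fix c :: 'a
    let ?T = "{p \<in> S. c - p /\<^sub>R t \<in> polar_at p}"
    have T_borel: "?T \<in> sets borel"
    proof -
      have "?T = {p \<in> space borel. p \<in> S \<and> (p, c - p /\<^sub>R t) \<in> ?G}" by auto
      also have "\<dots> \<in> sets borel" by measurable
      finally show ?thesis .
    qed
    have "(\<integral>\<^sup>+p. ?f p (c - p /\<^sub>R t) \<partial>lborel) = (\<integral>\<^sup>+p. indicator ?T p \<partial>lborel)"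
      by (intro nn_integral_cong) (auto simp: indicator_def)
    also have "\<dots> = emeasure lborel ?T" using T_borel by simp
    also have "\<dots> \<le> indicator (cball (0::'a) ((1 + B) / t)) c * ennreal (m / r)"
    proof (cases "?T = {}")
      case True
      show ?thesis unfolding True by simp
    next
      case False
      \<comment> \<open>One point \<open>p0\<close> of the slice controls everything: it bounds
        \<open>c\<close>, and by \<open>polar_at_slice_diam\<close> the slice stays within distance
        \<open>r\<close> of it, where \<open>shell_inter_ball_volume\<close> applies.\<close>
      then obtain p0 where p0: "p0 \<in> S" "c - p0 /\<^sub>R t \<in> polar_at p0" by auto
      then have "norm (c - p0 /\<^sub>R t) \<le> 1 / depth p0" by (intro polar_at_norm_le SC)
      also have "\<dots> \<le> 1 / t" using p0(1) t by (intro divide_left_mono) (auto simp: S_def)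
      finally have "norm c \<le> 1 / t + norm (p0 /\<^sub>R t)"
        using norm_triangle_sub[of c "p0 /\<^sub>R t"] by linarith
      also have "\<dots> \<le> 1 / t + B / t" using B(1)[OF SC[OF p0(1)]] t by (simp add: field_simps)
      finally have c: "c \<in> cball 0 ((1 + B) / t)" by (simp add: add_divide_distrib)
      have "?T \<subseteq> {p \<in> cball p0 r. t < depth p \<and> depth p \<le> 2 * t}"
        using polar_at_slice_diam[OF t(1) SC[OF p0(1)] SC p0(2)] by (auto simp: S_def r_def)
      moreover have "{p \<in> cball p0 r. t < depth p \<and> depth p \<le> 2 * t} \<in> sets borel"
        by measurable
      ultimately have "ennreal r * emeasure lborel ?T \<le>
          ennreal r * emeasure lborel {p \<in> cball p0 r. t < depth p \<and> depth p \<le> 2 * t}"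
        by (intro mult_left_mono emeasure_mono) auto
      also have "\<dots> \<le> ennreal m"
        unfolding m_def n_def using SC[OF p0(1)] by (intro shell_inter_ball_volume o t r r0)
      finally have "ennreal r * emeasure lborel ?T / ennreal r \<le> ennreal m / ennreal r"
        by (rule divide_right_mono_ennreal)
      also have "ennreal r * emeasure lborel ?T / ennreal r = emeasure lborel ?T"
        using r0 by (subst mult.commute, intro mult_divide_eq_ennreal) auto
      also have "ennreal m / ennreal r = ennreal (m / r)"
        using r0 t diameter_pos by (intro divide_ennreal) (auto simp: m_def)
      finally have "emeasure lborel ?T \<le> ennreal (m / r)" .
      with c show ?thesis by simp
    qed
    finally show "(\<integral>\<^sup>+p. ?f p (c - p /\<^sub>R t) \<partial>lborel) \<le> indicator (cball (0::'a) ((1 + B) / t)) c * ennreal (m / r)" .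
  qed
  also have "\<dots> = emeasure lborel (cball (0::'a) ((1 + B) / t)) * ennreal (m / r)"
    by (subst nn_integral_multc) (auto intro!: borel_measurable_indicator)
  also have "\<dots> = ennreal (unit_ball_vol n * ((1 + B) / t) ^ n * (m / r))"
    using t B(2) r0 m0 by (simp add: emeasure_cball ennreal_mult[symmetric] n_def)
  finally show ?thesis unfolding S_def m_def .
qed

text \<open>Counting powers of \<open>t\<close>: the ball of parameters \<open>c\<close> gives
  \<open>- n\<close>, the factor \<open>r ^ n / r\<close> with \<open>r = sqrt (2 * t)\<close> gives
  \<open>(n - 1) / 2\<close>, and the thickness of the shell gives 1.\<close>

lemma shell_polar_integral_powr:
  obtains K t0 where "K \<ge> 0" "t0 > 0"
    "\<And>t. 0 < t \<Longrightarrow> t \<le> t0 \<Longrightarrow>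
      (\<integral>\<^sup>+p. indicator {p. t < depth p \<and> depth p \<le> 2 * t} p * emeasure lborel (polar_at p) \<partial>lborel)
        \<le> ennreal (K * t powr ((1 - real DIM('a)) / 2))"
proof -
  obtain o' where o: "o' \<in> C" using nonempty by blast
  define a where "a = depth o'"
  have a: "a > 0" using o by (simp add: a_def depth_pos_iff)
  obtain B where B: "\<And>p. p \<in> C \<Longrightarrow> norm p \<le> B" "B > 0"
    using bounded unfolding bounded_pos by blast
  define n where "n = DIM('a)"
  define V where "V = unit_ball_vol n"
  \<comment> \<open>The three bounds ensure \<open>t \<le> a / 4\<close>,
    \<open>r \<le> a / 2\<close> and \<open>r \<le> 1\<close>.\<close>
  define t0 where "t0 = min (a / 4) (min (a\<^sup>2 / 8) (1 / 2))"
  define K where "K = V * (1 + B) ^ n * V * (1 + diameter C) ^ n * 8 / a * 2 powr ((real n - 1) / 2)"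
  have t0: "t0 > 0" using a by (simp add: t0_def)
  have K: "K \<ge> 0" using a B(2) diameter_pos by (simp add: K_def V_def)
  have bound: "(\<integral>\<^sup>+p. indicator {p. t < depth p \<and> depth p \<le> 2 * t} p * emeasure lborel (polar_at p) \<partial>lborel)
      \<le> ennreal (K * t powr ((1 - real n) / 2))" if t: "0 < t" "t \<le> t0" for t
  proof -
    define r where "r = sqrt (2 * t)"
    have r0: "r > 0" using t by (simp add: r_def)
    have "r\<^sup>2 \<le> (a / 2)\<^sup>2" "r\<^sup>2 \<le> 1\<^sup>2" using t by (auto simp: r_def t0_def power_divide)
    then have r: "r \<le> a / 2" "r \<le> 1"
      using a power2_le_imp_le[of r "a / 2"] power2_le_imp_le[of r 1] by auto
    have "r ^ n / r = r powr (real n - 1)" using r0 by (simp add: powr_diff powr_realpow)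
    also have "\<dots> = (2 * t) powr ((real n - 1) / 2)"
      using t by (simp add: r_def powr_half_sqrt[symmetric] powr_powr)
    also have "\<dots> = 2 powr ((real n - 1) / 2) * t powr ((real n - 1) / 2)"
      using t by (simp add: powr_mult)
    finally have rn: "r ^ n / r = 2 powr ((real n - 1) / 2) * t powr ((real n - 1) / 2)" .
    have "t powr ((1 - real n) / 2) = t powr ((real n - 1) / 2 - real n + 1)"
      by (rule arg_cong[of _ _ "\<lambda>e. t powr e"]) (simp add: field_simps)
    also have "\<dots> = t powr ((real n - 1) / 2) / t ^ n * t"
      using t by (simp add: powr_add powr_diff powr_realpow)
    finally have tn: "t powr ((1 - real n) / 2) = t powr ((real n - 1) / 2) / t ^ n * t" .
    have "V * ((1 + B) / t) ^ n * (V * (r * (1 + diameter C)) ^ n * (8 * t / a) / r)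
        = V * (1 + B) ^ n * V * (1 + diameter C) ^ n * 8 / a * (r ^ n / r) * (t / t ^ n)"
      by (simp add: power_mult_distrib power_divide mult_ac)
    also have "\<dots> = K * t powr ((1 - real n) / 2)"
      unfolding rn tn K_def by (simp add: mult_ac)
    finally have eq: "V * ((1 + B) / t) ^ n * (V * (r * (1 + diameter C)) ^ n * (8 * t / a) / r)
        = K * t powr ((1 - real n) / 2)" .
    have "t \<le> depth o' / 4" using t by (simp add: t0_def a_def)
    then have "(\<integral>\<^sup>+p. indicator {p. t < depth p \<and> depth p \<le> 2 * t} p * emeasure lborel (polar_at p) \<partial>lborel)
        \<le> ennreal (V * ((1 + B) / t) ^ n * (V * (r * (1 + diameter C)) ^ n * (8 * t / a) / r))"
      using shell_polar_integral_le[OF o t(1) _ _ _ B(1)] r B(2)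
      unfolding V_def n_def a_def r_def by auto
    then show ?thesis unfolding eq .
  qed
  show thesis using that[OF K t0] bound by (simp add: n_def)
qed

text \<open>Where the depth exceeds \<open>t0\<close> the integrand is bounded on a set of finite
  volume. The dyadic shells below \<open>t0\<close> contribute at most a geometric series of ratio
  \<open>(1 / 2) powr (s + \<alpha>)\<close>, and the hypothesis on \<open>s\<close> says that
  \<open>s + \<alpha>\<close> is positive.\<close>

lemma polar_integral_finite:
  assumes "s > (real DIM('a) - 1) / 2"
  shows "(\<integral>\<^sup>+p. indicator C p * ennreal (depth p powr s) * emeasure lborel (polar_at p) \<partial>lborel) < \<infinity>"
proof -
  define \<alpha> where "\<alpha> = (1 - real DIM('a)) / 2"
  define d where "d = real DIM('a)"
  have "d \<ge> 1" using DIM_positive[where 'a='a] by (simp add: d_def Suc_le_eq)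
  moreover have "s > (d - 1) / 2" "\<alpha> = (1 - d) / 2" using assms by (simp_all add: d_def \<alpha>_def)
  ultimately have s: "s + \<alpha> > 0" "s > 0" by simp_all
  obtain K t0 where K: "K \<ge> 0" and t0: "t0 > 0" and shell:
    "\<And>t. 0 < t \<Longrightarrow> t \<le> t0 \<Longrightarrow>
      (\<integral>\<^sup>+p. indicator {p. t < depth p \<and> depth p \<le> 2 * t} p * emeasure lborel (polar_at p) \<partial>lborel)
        \<le> ennreal (K * t powr \<alpha>)"
    using shell_polar_integral_powr unfolding \<alpha>_def by blast
  \<comment> \<open>Shell number \<open>k\<close> runs from \<open>t k\<close> to
    \<open>2 * t k\<close>; with the exponent \<open>Suc k\<close> the outermost one ends at
    \<open>t0\<close>.\<close>
  define t where "t k = t0 / 2 ^ Suc k" for k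
  have t: "0 < t k" "t k \<le> t0" for k
    using t0 one_le_power[of "2 :: real" "Suc k"] by (auto simp: t_def divide_le_eq)
  let ?g = "\<lambda>p. emeasure lborel (polar_at p)"
  let ?f = "\<lambda>p. indicator C p * ennreal (depth p powr s) * ?g p"
  let ?S = "\<lambda>k. {p. t k < depth p \<and> depth p \<le> 2 * t k}"
  define M where "M = ennreal (diameter C powr s * (unit_ball_vol DIM('a) * (1 / t0) ^ DIM('a)))"
  have C_borel [measurable]: "C \<in> sets borel" using open_C by simp
  have pointwise: "?f p \<le> M * indicator C p + (\<Sum>k. ennreal ((2 * t k) powr s) * (indicator (?S k) p * ?g p))" for p
  proof (cases "p \<in> C")
    case p: True
    show ?thesis
    proof (cases "depth p > t0")
      case True
      have "?g p \<le> emeasure lborel (cball (0::'a) (1 / t0))"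
      proof (rule emeasure_mono)
        have "1 / depth p \<le> 1 / t0" using True t0 by (simp add: field_simps)
        then show "polar_at p \<subseteq> cball 0 (1 / t0)" using polar_at_norm_le[OF p] by fastforce
      qed simp
      moreover have "depth p powr s \<le> diameter C powr s"
        using depth_le_diameter depth_nonneg s by (intro powr_mono2) auto
      ultimately have "ennreal (depth p powr s) * ?g p \<le> M"
        unfolding M_def using t0 by (auto simp: emeasure_cball ennreal_mult intro!: mult_mono)
      then show ?thesis using p by (simp add: add_increasing2)
    next
      case False
      \<comment> \<open>As the depth is at most \<open>t0\<close>, \<open>j\<close> is not 0, and
        minimality puts \<open>p\<close> into the shell of index \<open>j - 1\<close>.\<close>
      define j where "j = (LEAST j. t0 / 2 ^ j < depth p)"
      have "\<exists>j. t0 / 2 ^ j < depth p"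
      proof -
        obtain j where "(1 / 2) ^ j < depth p / t0"
          using real_arch_pow_inv[of "depth p / t0" "1 / 2"] p t0 depth_pos_iff by auto
        then show ?thesis using t0 by (auto simp: field_simps power_one_over)
      qed
      then have j: "t0 / 2 ^ j < depth p" unfolding j_def by (rule LeastI_ex)
      with False have "j \<noteq> 0" by (metis div_by_1 power_0)
      then obtain k where k: "j = Suc k" using not0_implies_Suc by blast
      have "\<not> t0 / 2 ^ k < depth p" using not_less_Least[of k "\<lambda>j. t0 / 2 ^ j < depth p"] k
        by (simp add: j_def[symmetric])
      then have pk: "p \<in> ?S k" using j by (simp add: k t_def)
      have "?f p \<le> ennreal ((2 * t k) powr s) * (indicator (?S k) p * ?g p)"
        using pk p s depth_nonneg[of p]
        by (auto intro!: mult_right_mono ennreal_leI powr_mono2)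
      also have "\<dots> \<le> (\<Sum>k. ennreal ((2 * t k) powr s) * (indicator (?S k) p * ?g p))"
        using sum_le_suminf[of "\<lambda>k. ennreal ((2 * t k) powr s) * (indicator (?S k) p * ?g p)" "{k}"] by simp
      finally show ?thesis by (simp add: add_increasing)
    qed
  qed simp
  define q where "q = (1 / 2) powr (s + \<alpha>)"
  have q: "0 \<le> q" "q < 1" using s powr_less_mono2[of "s + \<alpha>" "1 / 2" 1] by (auto simp: q_def)
  define K' where "K' = 2 powr s * K * t0 powr (s + \<alpha>) * q"
  have K': "K' \<ge> 0" using K q by (simp add: K'_def)
  have shell_term: "ennreal ((2 * t k) powr s) * (\<integral>\<^sup>+p. indicator (?S k) p * ?g p \<partial>lborel) \<le> ennreal (K' * q ^ k)" for k
  proof -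
    have "ennreal ((2 * t k) powr s) * (\<integral>\<^sup>+p. indicator (?S k) p * ?g p \<partial>lborel)
        \<le> ennreal ((2 * t k) powr s) * ennreal (K * t k powr \<alpha>)"
      by (intro mult_left_mono shell t) simp
    also have "\<dots> = ennreal (2 powr s * K * t k powr (s + \<alpha>))"
      using K t[of k] by (simp add: ennreal_mult'[symmetric] powr_mult powr_add mult_ac)
    also have "t k powr (s + \<alpha>) = t0 powr (s + \<alpha>) * q ^ Suc k"
    proof -
      have pow: "((1 / 2) ^ m) powr (s + \<alpha>) = ((1 / 2) powr (s + \<alpha>)) ^ m" for m :: nat
        by (simp add: powr_realpow[symmetric] powr_powr mult.commute del: power_one_over)
      have "t k = t0 * (1 / 2) ^ Suc k" by (simp add: t_def power_one_over)
      also have "\<dots> powr (s + \<alpha>) = t0 powr (s + \<alpha>) * ((1 / 2) powr (s + \<alpha>)) ^ Suc k"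
        using t0 pow[of "Suc k"] by (simp only: powr_mult)
      finally show ?thesis by (simp add: q_def)
    qed
    finally show ?thesis by (simp add: K'_def mult_ac)
  qed
  have "(\<integral>\<^sup>+p. ?f p \<partial>lborel) \<le>
      (\<integral>\<^sup>+p. M * indicator C p + (\<Sum>k. ennreal ((2 * t k) powr s) * (indicator (?S k) p * ?g p)) \<partial>lborel)"
    by (intro nn_integral_mono pointwise)
  also have "\<dots> = M * emeasure lborel C +
      (\<Sum>k. ennreal ((2 * t k) powr s) * (\<integral>\<^sup>+p. indicator (?S k) p * ?g p \<partial>lborel))"
    by (simp add: nn_integral_add nn_integral_suminf nn_integral_cmult nn_integral_cmult_indicator)
  also have "\<dots> \<le> M * emeasure lborel C + (\<Sum>k. ennreal (K' * q ^ k))"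
    by (intro add_left_mono suminf_le shell_term) auto
  also have "(\<Sum>k. ennreal (K' * q ^ k)) = ennreal (\<Sum>k. K' * q ^ k)"
    using K' q by (intro suminf_ennreal2 summable_mult summable_geometric) auto
  also have "M * emeasure lborel C + ennreal (\<Sum>k. K' * q ^ k) < \<infinity>"
    using emeasure_bounded_finite[OF bounded]
    by (auto simp: M_def ennreal_mult_less_top)
  finally show ?thesis .
qed

end

section \<open>The Rayleigh quotients\<close>

context bounded_open_convex
begin

definition hilbert_density :: "'a \<Rightarrow> ennreal" where
  "hilbert_density p = ennreal (measure lborel (ball (0::'a) 1) / measure lborel {v. finsler C p v < 1})"

text \<open>The indicator is there because \<open>finsler\<close> is controlled only on
  \<open>C\<close>. The volume of the unit ball is measurable in \<open>p\<close> as the measure of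
  a section of an open set.\<close>

lemma hilbert_density_measurable:
  "(\<lambda>p. indicator C p * hilbert_density p) \<in> borel_measurable borel"
proof -
  have C_borel [measurable]: "C \<in> sets borel" using open_C by simp
  let ?W = "{(p, v). p \<in> C \<and> finsler C p v < 1}"
  have "(\<lambda>p. emeasure lborel (Pair p -` ?W)) \<in> borel_measurable lborel"
    using borel_open[OF open_finsler_balls]
    by (intro lborel.measurable_emeasure_Pair) (simp only: lborel_prod sets_lborel)
  then have [measurable]: "(\<lambda>p. emeasure lborel (Pair p -` ?W)) \<in> borel_measurable borel" by simp
  have "(\<lambda>p. indicator C p * hilbert_density p) = (\<lambda>p. indicator C p *
      ennreal (measure lborel (ball (0::'a) 1) / enn2real (emeasure lborel (Pair p -` ?W))))"
    by (auto simp: hilbert_density_def measure_def indicator_def vimage_def)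
  also have "\<dots> \<in> borel_measurable borel" by measurable
  finally show ?thesis .
qed

lemma nn_integral_hilbert_measure:
  assumes [measurable]: "f \<in> borel_measurable borel"
  shows "(\<integral>\<^sup>+p. f p \<partial>hilbert_measure C) = (\<integral>\<^sup>+p. indicator C p * hilbert_density p * f p \<partial>lborel)"
proof -
  have C_borel: "C \<in> sets borel" using open_C by simp
  have "hilbert_density \<in> borel_measurable (restrict_space lborel C)"
    using hilbert_density_measurable C_borel
    by (subst borel_measurable_restrict_space_iff_ennreal) (auto simp: mult.commute)
  moreover have "f \<in> borel_measurable (restrict_space lborel C)"
    by (intro measurable_restrict_space1) simp
  ultimately have "(\<integral>\<^sup>+p. f p \<partial>hilbert_measure C) = (\<integral>\<^sup>+p. hilbert_density p * f p \<partial>restrict_space lborel C)"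
    unfolding hilbert_measure_def hilbert_density_def[symmetric] by (rule nn_integral_density)
  also have "\<dots> = (\<integral>\<^sup>+p. hilbert_density p * f p * indicator C p \<partial>lborel)"
    using C_borel by (intro nn_integral_restrict_space) simp
  finally show ?thesis by (simp add: mult_ac)
qed

lemma space_hilbert_measure: "space (hilbert_measure C) = C"
  by (simp add: hilbert_measure_def space_restrict_space)

lemma emeasure_C_pos: "emeasure lborel C > 0"
proof -
  obtain p where "p \<in> C" using nonempty by blast
  then obtain e where e: "e > 0" "ball p e \<subseteq> C" using open_C open_contains_ball by blast
  have "0 < emeasure lborel (ball p e)" using e by (simp add: emeasure_ball)
  also have "\<dots> \<le> emeasure lborel C" using e open_C by (intro emeasure_mono) auto
  finally show ?thesis .
qed

lemma trunc_power_nonneg: "s \<ge> 0 \<Longrightarrow> e \<ge> 0 \<Longrightarrow> trunc_power e s p \<ge> 0"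
  by (simp add: trunc_power_def powr_mono2)

lemma trunc_power_antimono:
  assumes "s \<ge> 0" "0 \<le> e" "e \<le> e'"
  shows "trunc_power e' s p \<le> trunc_power e s p"
proof (cases "depth p \<ge> e'")
  case True
  then show ?thesis using assms by (simp add: trunc_power_def powr_mono2)
next
  case False
  then have "trunc_power e' s p = 0" by (simp add: trunc_power_def)
  then show ?thesis using trunc_power_nonneg assms by simp
qed

lemma trunc_power_measurable [measurable]: "trunc_power e s \<in> borel_measurable borel"
  unfolding trunc_power_def by measurable

text \<open>The weight \<open>depth powr s\<close> is the square of the limit \<open>depth powr (s / 2)\<close> of the test
  functions, whose logarithmic derivative has dual norm at most \<open>s\<close>.\<close>

lemma bottom_spectrum_mult_le:
  assumes s: "s > 0" and e: "e > 0" and o: "o' \<in> C" "e < depth o'"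
  shows "bottom_spectrum C * (\<integral>\<^sup>+p. ennreal ((trunc_power e (s / 2) p)\<^sup>2) \<partial>hilbert_measure C)
    \<le> ennreal (s\<^sup>2) * (\<integral>\<^sup>+p. ennreal (depth p powr s) \<partial>hilbert_measure C)"
proof -
  let ?f = "trunc_power e (s / 2)"
  let ?D = "\<lambda>p. dual_norm C p (frechet_derivative ?f (at p))"
  let ?N = "\<integral>\<^sup>+p\<in>{p. ?f differentiable (at p)}. ennreal ((?D p)\<^sup>2) \<partial>hilbert_measure C"
  let ?E = "\<integral>\<^sup>+p. ennreal ((?f p)\<^sup>2) \<partial>hilbert_measure C"
  have "?N \<le> (\<integral>\<^sup>+p. ennreal (s\<^sup>2) * ennreal (depth p powr s) \<partial>hilbert_measure C)"
  proof (rule nn_integral_mono)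
    fix p assume "p \<in> space (hilbert_measure C)"
    then have p: "p \<in> C" by (simp add: space_hilbert_measure)
    show "ennreal ((?D p)\<^sup>2) * indicator {p. ?f differentiable (at p)} p
        \<le> ennreal (s\<^sup>2) * ennreal (depth p powr s)"
    proof (cases "?f differentiable (at p)")
      case True
      have "0 \<le> ?D p" "?D p \<le> (if depth p < e then 0 else 2 * (s / 2) * depth p powr (s / 2))"
        using dual_norm_trunc_power[OF e _ p True] s by auto
      then have "0 \<le> ?D p" "?D p \<le> s * depth p powr (s / 2)" using s by (auto split: if_splits)
      then have "(?D p)\<^sup>2 \<le> (s * depth p powr (s / 2))\<^sup>2" by (rule power_mono[rotated])
      also have "\<dots> = s\<^sup>2 * depth p powr s"
        by (simp add: power_mult_distrib power2_eq_square powr_add[symmetric])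
      finally show ?thesis using True by (simp add: ennreal_mult'[symmetric] ennreal_leI)
    qed simp
  qed
  also have "\<dots> = ennreal (s\<^sup>2) * (\<integral>\<^sup>+p. ennreal (depth p powr s) \<partial>hilbert_measure C)"
  proof (rule nn_integral_cmult)
    have "(\<lambda>p. ennreal (depth p powr s)) \<in> borel_measurable (restrict_space lborel C)"
      by (intro measurable_restrict_space1) simp
    then show "(\<lambda>p. ennreal (depth p powr s)) \<in> borel_measurable (hilbert_measure C)"
      by (simp add: hilbert_measure_def)
  qed
  finally have N: "?N \<le> ennreal (s\<^sup>2) * (\<integral>\<^sup>+p. ennreal (depth p powr s) \<partial>hilbert_measure C)" .
  have "test_function C ?f" using test_function_trunc_power[OF e _ o] s by simp
  then have le: "bottom_spectrum C \<le> ?N / ?E"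
    unfolding bottom_spectrum_def by (intro INF_lower) simp
  have "bottom_spectrum C * ?E \<le> ?N"
  proof -
    \<comment> \<open>In \<open>ennreal\<close>, \<open>?E\<close> cancels against itself only when
      it is neither 0 nor \<open>top\<close>. The value 0 makes the left-hand side 0, and
      \<open>top\<close> makes the quotient, hence the infimum, 0.\<close>
    consider "?E = 0" | "?E = top" | "?E \<noteq> 0" "?E \<noteq> top" by blast
    then show ?thesis
    proof cases
      case 2
      then have "bottom_spectrum C = 0" using le by (simp add: ennreal_divide_top)
      then show ?thesis by simp
    next
      case 3
      have "bottom_spectrum C * ?E \<le> ?N / ?E * ?E" by (intro mult_right_mono le) simp
      also have "\<dots> = ?N * (?E / ?E)" by (simp add: divide_ennreal_def mult_ac)
      also have "\<dots> = ?N" using 3 by (simp add: ennreal_divide_self less_top)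
      finally show ?thesis .
    qed simp
  qed
  with N show ?thesis by (rule order_trans[rotated])
qed

text \<open>As the cutoff tends to 0, the denominators increase to the integral of
  \<open>depth powr s\<close>, which also bounds the energies up to the factor
  \<open>s\<^sup>2\<close>. This integral is finite and positive, so it cancels.\<close>

lemma bottom_spectrum_le_square:
  assumes s: "s > 0" and pos: "\<And>p. p \<in> C \<Longrightarrow> hilbert_density p > 0"
    and fin: "(\<integral>\<^sup>+p. ennreal (depth p powr s) \<partial>hilbert_measure C) < \<infinity>"
  shows "bottom_spectrum C \<le> ennreal (s\<^sup>2)"
proof (rule ccontr)
  let ?I = "\<integral>\<^sup>+p. ennreal (depth p powr s) \<partial>hilbert_measure C"
  assume "\<not> bottom_spectrum C \<le> ennreal (s\<^sup>2)"
  then have "ennreal (s\<^sup>2) < bottom_spectrum C" by simp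
  \<comment> \<open>The infimum might be \<open>top\<close> a priori; a finite \<open>c\<close> in
    between lets multiplication pass to the limit.\<close>
  from dense[OF this] obtain c where c: "ennreal (s\<^sup>2) < c" "c < bottom_spectrum C" by blast
  obtain o' where o: "o' \<in> C" using nonempty by blast
  then have depth_o: "depth o' > 0" by (simp add: depth_pos_iff)
  \<comment> \<open>The shift by 2 keeps \<open>e k\<close> below \<open>depth o'\<close> already
    for \<open>k = 0\<close>, so that every test function is nonzero at \<open>o'\<close>.\<close>
  define e where "e k = depth o' / real (k + 2)" for k
  have e: "0 < e k" "e k < depth o'" for k
  proof -
    have "depth o' * 1 < depth o' * real (k + 2)" using depth_o by (intro mult_strict_left_mono) auto
    then show "e k < depth o'" by (simp add: e_def divide_less_eq)
  qed (use depth_o in \<open>simp add: e_def\<close>)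
  have e_dec: "e k' \<le> e k" if "k \<le> k'" for k k'
    using that depth_o by (auto simp: e_def intro!: divide_left_mono)
  have e_lim: "e \<longlonglongrightarrow> 0"
    unfolding e_def using LIMSEQ_ignore_initial_segment[OF lim_const_over_n[of "depth o'"], of 2] by simp
  note dens [measurable] = hilbert_density_measurable
  let ?g = "\<lambda>k p. indicator C p * hilbert_density p * ennreal ((trunc_power (e k) (s / 2) p)\<^sup>2)"
  let ?h = "\<lambda>p. indicator C p * hilbert_density p * ennreal (depth p powr s)"
  have "(\<lambda>k. integral\<^sup>N lborel (?g k)) \<longlonglongrightarrow> integral\<^sup>N lborel ?h"
  proof (rule nn_integral_LIMSEQ)
    show "incseq ?g"
    proof (intro incseq_SucI le_funI)
      fix k p
      have "trunc_power (e k) (s / 2) p \<le> trunc_power (e (Suc k)) (s / 2) p"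
        using s e(1)[of "Suc k"] e_dec[of k "Suc k"] by (intro trunc_power_antimono) auto
      moreover have "0 \<le> trunc_power (e k) (s / 2) p" using s e(1)[of k] by (intro trunc_power_nonneg) auto
      ultimately show "?g k p \<le> ?g (Suc k) p"
        by (intro mult_left_mono ennreal_leI power_mono) auto
    qed
    show "?g k \<in> borel_measurable lborel" for k by measurable
    show "(\<lambda>k. ?g k p) \<longlonglongrightarrow> ?h p" for p
    proof (cases "p \<in> C")
      case True
      then have dp: "depth p > 0" by (simp add: depth_pos_iff)
      have "(\<lambda>k. max (depth p) (e k)) \<longlonglongrightarrow> max (depth p) 0"
        by (intro tendsto_intros e_lim)
      then have "(\<lambda>k. max (depth p) (e k) powr (s / 2)) \<longlonglongrightarrow> depth p powr (s / 2)"
        using dp by (intro tendsto_powr) auto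
      moreover have "(\<lambda>k. e k powr (s / 2)) \<longlonglongrightarrow> 0"
        using s e(1) by (intro tendsto_zero_powrI[OF e_lim tendsto_const]) (auto intro!: always_eventually less_imp_le)
      ultimately have "(\<lambda>k. (trunc_power (e k) (s / 2) p)\<^sup>2) \<longlonglongrightarrow> (depth p powr (s / 2) - 0)\<^sup>2"
        unfolding trunc_power_def by (intro tendsto_power tendsto_diff)
      also have "(depth p powr (s / 2) - 0)\<^sup>2 = depth p powr s"
        by (simp add: power2_eq_square powr_add[symmetric])
      finally show ?thesis
        by (intro ennreal_tendsto_cmult tendsto_ennrealI) (auto simp: hilbert_density_def indicator_def)
    qed simp
  qed
  then have lim: "(\<lambda>k. c * integral\<^sup>N lborel (?g k)) \<longlonglongrightarrow> c * integral\<^sup>N lborel ?h"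
    using less_le_trans[OF c(2) top_greatest] by (intro ennreal_tendsto_cmult)
  have I: "integral\<^sup>N lborel ?h = ?I" by (rule nn_integral_hilbert_measure[symmetric]) measurable
  have "c * integral\<^sup>N lborel (?g k) \<le> ennreal (s\<^sup>2) * ?I" for k
  proof -
    have "c * integral\<^sup>N lborel (?g k) \<le> bottom_spectrum C * integral\<^sup>N lborel (?g k)"
      using c(2) by (intro mult_right_mono) auto
    moreover have "(\<integral>\<^sup>+p. ennreal ((trunc_power (e k) (s / 2) p)\<^sup>2) \<partial>hilbert_measure C) = integral\<^sup>N lborel (?g k)"
      by (rule nn_integral_hilbert_measure) measurable
    ultimately show ?thesis using bottom_spectrum_mult_le[OF s e(1) o e(2)[of k]] by simp
  qed
  then have "c * ?I \<le> ennreal (s\<^sup>2) * ?I"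
    using LIMSEQ_le_const2[OF lim] unfolding I by blast
  moreover have "?I \<noteq> 0"
  proof
    assume "?I = 0"
    then have "AE p in lborel. ?h p = 0" unfolding I[symmetric] by (subst (asm) nn_integral_0_iff_AE) measurable
    then have "AE p in lborel. p \<notin> C"
    proof (rule AE_mp, intro AE_I2 impI)
      fix p assume "?h p = 0"
      then show "p \<notin> C" using pos[of p] by (auto simp flip: depth_pos_iff)
    qed
    then have "emeasure lborel C = 0"
      using open_C by (subst (asm) AE_iff_measurable[of C]) auto
    with emeasure_C_pos show False by simp
  qed
  ultimately have "c \<le> ennreal (s\<^sup>2)"
    using fin ennreal_mult_le_mult_iff[of ?I c "ennreal (s\<^sup>2)"] by (simp add: mult.commute)
  with c(1) show False by simp
qed

end

text \<open>The volume inequality bounds the Finsler ball from below by a constant over the polar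
  volume. It also excludes the value 0 for the volume of the ball, at which the division would
  return density 0.\<close>

lemma hilbert_density_pos_le_polar:
  fixes C :: "(real^'n) set"
  assumes "bounded_open_convex C"
  obtains K where "\<And>p. p \<in> C \<Longrightarrow> bounded_open_convex.hilbert_density C p > 0"
    "\<And>p. p \<in> C \<Longrightarrow> bounded_open_convex.hilbert_density C p
      \<le> ennreal K * emeasure lborel (bounded_open_convex.polar_at C p)"
proof -
  interpret bounded_open_convex C by fact
  define q where "q = (2 / real CARD('n)) ^ CARD('n) * (1 / real CARD('n)) ^ CARD('n)"
  define \<omega> where "\<omega> = measure lborel (ball (0::real^'n) 1)"
  have q: "q > 0" by (simp add: q_def)
  have \<omega>: "\<omega> > 0" by (simp add: \<omega>_def content_ball_pos)
  have main: "hilbert_density p > 0" "hilbert_density p \<le> ennreal (\<omega> / q) * emeasure lborel (polar_at p)"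
    if p: "p \<in> C" for p
  proof -
    let ?F = "measure lborel {v. finsler C p v < 1}" and ?P = "measure lborel (polar_at p)"
    have le: "q \<le> ?F * ?P"
      unfolding q_def using finsler_ball_polar_volume[OF assms p] by simp
    then have F: "?F > 0" using q measure_nonneg[of lborel "{v. finsler C p v < 1}"]
      by (cases "?F = 0") (auto simp: less_le)
    then show "hilbert_density p > 0" using \<omega> by (simp add: hilbert_density_def \<omega>_def)
    have "\<omega> / ?F \<le> \<omega> / q * ?P" using le F q \<omega> by (simp add: field_simps)
    then have "hilbert_density p \<le> ennreal (\<omega> / q) * ennreal ?P"
      unfolding hilbert_density_def \<omega>_def[symmetric] using \<omega> q
      by (simp add: ennreal_mult'[symmetric] ennreal_leI)
    also have "ennreal ?P = emeasure lborel (polar_at p)"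
      using emeasure_bounded_finite[OF bounded_polar_at[OF p]]
      by (intro emeasure_eq_ennreal_measure[symmetric]) simp
    finally show "hilbert_density p \<le> ennreal (\<omega> / q) * emeasure lborel (polar_at p)" .
  qed
  show thesis by (rule that[OF main])
qed

theorem theorem3:
  fixes C :: "(real ^ 'n) set"
  assumes "C \<noteq> {}" and "bounded C" and "open C" and "convex C"
  shows "bottom_spectrum C \<le> ennreal ((real CARD('n) - 1)\<^sup>2 / 4)"
proof -
  interpret bounded_open_convex C using assms by unfold_locales
  obtain K where pos: "\<And>p. p \<in> C \<Longrightarrow> hilbert_density p > 0"
    and K: "\<And>p. p \<in> C \<Longrightarrow> hilbert_density p \<le> ennreal K * emeasure lborel (polar_at p)"
    using hilbert_density_pos_le_polar[OF bounded_open_convex_axioms] by blast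
  define a where "a = (real CARD('n) - 1) / 2"
  have a: "a \<ge> 0" using zero_less_card_finite[where 'a='n] by (simp add: a_def Suc_le_eq)
  have bound: "bottom_spectrum C \<le> ennreal (s\<^sup>2)" if s: "s > a" for s
  proof (rule bottom_spectrum_le_square)
    show "s > 0" using s a by simp
    show "hilbert_density p > 0" if "p \<in> C" for p by (rule pos[OF that])
    have C_borel [measurable]: "C \<in> sets borel" using open_C by simp
    have "(\<integral>\<^sup>+p. ennreal (depth p powr s) \<partial>hilbert_measure C)
        = (\<integral>\<^sup>+p. indicator C p * hilbert_density p * ennreal (depth p powr s) \<partial>lborel)"
      by (rule nn_integral_hilbert_measure) measurable
    also have "\<dots> \<le> (\<integral>\<^sup>+p. ennreal K * (indicator C p * ennreal (depth p powr s) * emeasure lborel (polar_at p)) \<partial>lborel)"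
    proof (rule nn_integral_mono)
      fix p
      show "indicator C p * hilbert_density p * ennreal (depth p powr s)
          \<le> ennreal K * (indicator C p * ennreal (depth p powr s) * emeasure lborel (polar_at p))"
      proof (cases "p \<in> C")
        case True
        then show ?thesis using mult_right_mono[OF K[OF True], of "ennreal (depth p powr s)"] by (simp add: mult_ac)
      qed simp
    qed
    also have "\<dots> = ennreal K * (\<integral>\<^sup>+p. indicator C p * ennreal (depth p powr s) * emeasure lborel (polar_at p) \<partial>lborel)"
      by (rule nn_integral_cmult) measurable
    also have "\<dots> < \<infinity>"
      using polar_integral_finite[of s] s by (simp add: a_def ennreal_mult_less_top)
    finally show "(\<integral>\<^sup>+p. ennreal (depth p powr s) \<partial>hilbert_measure C) < \<infinity>" .
  qed
  \<comment> \<open>Finiteness of the integral was shown for \<open>s > a\<close>, so the bound at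
    \<open>s = a\<close> is reached as a limit.\<close>
  have "(\<lambda>k. ennreal ((a + inverse (real (Suc k)))\<^sup>2)) \<longlonglongrightarrow> ennreal ((a + 0)\<^sup>2)"
    by (intro tendsto_ennrealI tendsto_intros LIMSEQ_inverse_real_of_nat)
  then have "bottom_spectrum C \<le> ennreal ((a + 0)\<^sup>2)"
    by (rule LIMSEQ_le_const) (auto intro!: exI[of _ 0] bound)
  also have "(a + 0)\<^sup>2 = (real CARD('n) - 1)\<^sup>2 / 4"
    by (simp add: a_def power_divide)
  finally show ?thesis .
qed

end
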